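(* There exist hypergraphs $\Lambda_1$ and $\Lambda_2$ such that $\Lambda_1\cong_{\rm q}\Lambda_2$ while $\Lambda_1\not\cong_{\rm loc}\Lambda_2$; that is, the hypergraph isomorphism game $\mathrm{HypIso}(\Lambda_1,\Lambda_2)$ has a perfect quantum strategy but no perfect local strategy.
   Context: Hypergraphs. A hypergraph $\Lambda=(V,E)$ consists of a finite set $V$ of vertices and a finite non-empty family $E$ of hyperedges, each $e\in E$ being identified with a subset of $V$; repeated hyperedges are allowed, and two hyperedges are equal only if they are the same element of $E$. All hypergraphs are assumed full: every vertex lies in some hyperedge. Correlations. For finite sets $X,Y,A,B$, a correlation is a family $p=\{p(a,b|x,y)\}$ of conditional probability distributions on $A\times B$. It is quantum ($p\in\mathcal C_{\rm q}$) if $p(a,b|x,y)=\langle (E_{x,a}\otimes F_{y,b})\xi,\xi\rangle$ for finite-dimensional Hilbert spaces $H_A,H_B$, a unit vector $\xi\in H_A\otimes H_B$, and families of positive operators with $\sum_aE_{x,a}=I$ for all $x$, $\sum_bF_{y,b}=I$ for all $y$. It is local ($p\in\mathcal C_{\rm loc}$) if it is a finite convex combination $\sum_i\lambda_i p^1_i(a|x)p^2_i(b|y)$ with $p_i^1(\cdot|x)$, $p_i^2(\cdot|y)$ probability distributions. A non-local game is $\mathcal G=(X,Y,A,B,\lambda)$ with $\lambda:X\times Y\times A\times B\to\{0,1\}$; a perfect ${\rm t}$-strategy is $p\in\mathcal C_{\rm t}$ with $p(a,b|x,y)=0$ whenever $\lambda(x,y,a,b)=0$. The game. Given $\Lambda_i=(V_i,E_i)$,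 $i=1,2$, the game $\mathrm{HypIso}(\Lambda_1,\Lambda_2)$ has all question and answer sets equal to $V_1\sqcup V_2\sqcup E_1\sqcup E_2$, and $\lambda(x,y,a,b)=1$ iff: (i) if $x\in V_i$ then $a\in V_{3-i}$, if $x\in E_i$ then $a\in E_{3-i}$, and similarly for $(y,b)$; (ii) if $x\in V_i$ and $y\in E_i$, then $x\in y\iff a\in b$; (iii) if $x,y$ are both vertices, let $v_A,w_A$ be the elements of $\{x,a\}$ in $V_1,V_2$ and $v_B,w_B$ the elements of $\{y,b\}$ in $V_1,V_2$; then the relation between $v_A,v_B$ in $\Lambda_1$ (equal / adjacent, i.e. distinct and in a common hyperedge / distinct non-adjacent) is the same as that between $w_A,w_B$ in $\Lambda_2$; (iv) if $x,y$ are both hyperedges, with the analogous notation $e_A,e_B\in E_1$, $f_A,f_B\in E_2$, the relation between $e_A,e_B$ (equal / intersecting, i.e. distinct with non-empty intersection / disjoint) is the same as that between $f_A,f_B$. Write $\Lambda_1\cong_{\rm t}\Lambda_2$ if $\mathrm{HypIso}(\Lambda_1,\Lambda_2)$ has a perfect ${\rm t}$-strategy. *)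

theory Defs
  imports "Jordan_Normal_Form.Matrix" "Jordan_Normal_Form.Conjugate"
begin

section \<open>Hypergraphs\<close>

text \<open>Hyperedges are names \<open>e\<close>, identified with the vertex set \<open>inc \<Lambda> e\<close>.  The map
  \<open>inc \<Lambda>\<close> need not be injective (repeated hyperedges), and equality of hyperedges is
  equality of names.\<close>

record ('v, 'e) hypergraph =
  verts :: "'v set"
  hedges :: "'e set"
  inc :: "'e \<Rightarrow> 'v set"

definition is_hypergraph :: "('v, 'e) hypergraph \<Rightarrow> bool" where
  "is_hypergraph \<Lambda> \<longleftrightarrow>
     finite (verts \<Lambda>) \<and> finite (hedges \<Lambda>) \<and> hedges \<Lambda> \<noteq> {} \<and>
     (\<forall>e\<in>hedges \<Lambda>. inc \<Lambda> e \<subseteq> verts \<Lambda>)"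

definition full :: "('v, 'e) hypergraph \<Rightarrow> bool" where
  "full \<Lambda> \<longleftrightarrow> (\<forall>v\<in>verts \<Lambda>. \<exists>e\<in>hedges \<Lambda>. v \<in> inc \<Lambda> e)"

datatype relation_type = Equal | Touching | Separate

definition vertex_rel :: "('v, 'e) hypergraph \<Rightarrow> 'v \<Rightarrow> 'v \<Rightarrow> relation_type" where
  "vertex_rel \<Lambda> v w =
     (if v = w then Equal
      else if \<exists>e\<in>hedges \<Lambda>. v \<in> inc \<Lambda> e \<and> w \<in> inc \<Lambda> e then Touching
      else Separate)"

definition edge_rel :: "('v, 'e) hypergraph \<Rightarrow> 'e \<Rightarrow> 'e \<Rightarrow> relation_type" where
  "edge_rel \<Lambda> e f =
     (if e = f then Equal
      else if inc \<Lambda> e \<inter> inc \<Lambda> f \<noteq> {} then Touching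
      else Separate)"

section \<open>Correlations\<close>

text \<open>\<open>p x y a b\<close> stands for \<open>p(a, b | x, y)\<close>.  Only the values at \<open>x \<in> X\<close>, \<open>y \<in> Y\<close>,
  \<open>a \<in> A\<close>, \<open>b \<in> B\<close> are meaningful.\<close>

type_synonym ('x, 'y, 'a, 'b) corr = "'x \<Rightarrow> 'y \<Rightarrow> 'a \<Rightarrow> 'b \<Rightarrow> real"

definition prob_dist :: "'c set \<Rightarrow> ('c \<Rightarrow> real) \<Rightarrow> bool" where
  "prob_dist C q \<longleftrightarrow> (\<forall>c\<in>C. 0 \<le> q c) \<and> (\<Sum>c\<in>C. q c) = 1"

definition correlation ::
    "'x set \<Rightarrow> 'y set \<Rightarrow> 'a set \<Rightarrow> 'b set \<Rightarrow> ('x, 'y, 'a, 'b) corr \<Rightarrow> bool" where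
  "correlation X Y A B p \<longleftrightarrow>
     (\<forall>x\<in>X. \<forall>y\<in>Y. prob_dist (A \<times> B) (\<lambda>(a, b). p x y a b))"

text \<open>Finite-dimensional Hilbert spaces are taken to be \<open>\<complex>\<^sup>d\<close> with
  \<open>\<langle>v, w\<rangle> = v \<bullet>c w\<close> (conjugate-linear in the second argument); the tensor product of
  \<open>\<complex>\<^sup>m\<close> and \<open>\<complex>\<^sup>n\<close> is \<open>\<complex>\<^sup>m\<^sup>n\<close>, where the basis vector \<open>e\<^sub>i \<otimes> e\<^sub>k\<close> has index \<open>i * n + k\<close>.\<close>

definition kron :: "complex mat \<Rightarrow> complex mat \<Rightarrow> complex mat" where
  "kron M N = mat (dim_row M * dim_row N) (dim_col M * dim_col N)
     (\<lambda>(i, j). M $$ (i div dim_row N, j div dim_col N) * N $$ (i mod dim_row N, j mod dim_col N))"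

text \<open>The order on \<^typ>\<open>complex\<close> is such that \<open>0 \<le> z\<close> entails that \<open>z\<close> is real, so
  positive operators are Hermitian.\<close>

definition positive_op :: "nat \<Rightarrow> complex mat \<Rightarrow> bool" where
  "positive_op d M \<longleftrightarrow>
     M \<in> carrier_mat d d \<and> (\<forall>v\<in>carrier_vec d. 0 \<le> (M *\<^sub>v v) \<bullet>c v)"

definition povm :: "nat \<Rightarrow> 'a set \<Rightarrow> ('a \<Rightarrow> complex mat) \<Rightarrow> bool" where
  "povm d A M \<longleftrightarrow>
     (\<forall>a\<in>A. positive_op d (M a)) \<and> mat d d (\<lambda>ij. \<Sum>a\<in>A. M a $$ ij) = 1\<^sub>m d"

definition quantum_correlations ::
    "'x set \<Rightarrow> 'y set \<Rightarrow> 'a set \<Rightarrow> 'b set \<Rightarrow> ('x, 'y, 'a, 'b) corr set" where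
  "quantum_correlations X Y A B = {p. correlation X Y A B p \<and>
     (\<exists>(m::nat) (n::nat) \<xi> M N.
        \<xi> \<in> carrier_vec (m * n) \<and> \<xi> \<bullet>c \<xi> = 1 \<and>
        (\<forall>x\<in>X. povm m A (M x)) \<and> (\<forall>y\<in>Y. povm n B (N y)) \<and>
        (\<forall>x\<in>X. \<forall>y\<in>Y. \<forall>a\<in>A. \<forall>b\<in>B.
           complex_of_real (p x y a b) = (kron (M x a) (N y b) *\<^sub>v \<xi>) \<bullet>c \<xi>))}"

definition local_correlations ::
    "'x set \<Rightarrow> 'y set \<Rightarrow> 'a set \<Rightarrow> 'b set \<Rightarrow> ('x, 'y, 'a, 'b) corr set" where
  "local_correlations X Y A B = {p. correlation X Y A B p \<and>
     (\<exists>(k::nat) c q r.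
        prob_dist {..<k} c \<and>
        (\<forall>i<k. \<forall>x\<in>X. prob_dist A (q i x)) \<and> (\<forall>i<k. \<forall>y\<in>Y. prob_dist B (r i y)) \<and>
        (\<forall>x\<in>X. \<forall>y\<in>Y. \<forall>a\<in>A. \<forall>b\<in>B.
           p x y a b = (\<Sum>i<k. c i * q i x a * r i y b)))}"

section \<open>Non-local games\<close>

record ('x, 'y, 'a, 'b) game =
  questionsA :: "'x set"
  questionsB :: "'y set"
  answersA :: "'a set"
  answersB :: "'b set"
  rule_fun :: "'x \<Rightarrow> 'y \<Rightarrow> 'a \<Rightarrow> 'b \<Rightarrow> bool"

definition perfect :: "('x, 'y, 'a, 'b) game \<Rightarrow> ('x, 'y, 'a, 'b) corr \<Rightarrow> bool" where
  "perfect G p \<longleftrightarrow>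
     (\<forall>x\<in>questionsA G. \<forall>y\<in>questionsB G. \<forall>a\<in>answersA G. \<forall>b\<in>answersB G.
        \<not> rule_fun G x y a b \<longrightarrow> p x y a b = 0)"

definition has_perfect_quantum_strategy :: "('x, 'y, 'a, 'b) game \<Rightarrow> bool" where
  "has_perfect_quantum_strategy G \<longleftrightarrow>
     (\<exists>p \<in> quantum_correlations (questionsA G) (questionsB G) (answersA G) (answersB G).
        perfect G p)"

definition has_perfect_local_strategy :: "('x, 'y, 'a, 'b) game \<Rightarrow> bool" where
  "has_perfect_local_strategy G \<longleftrightarrow>
     (\<exists>p \<in> local_correlations (questionsA G) (questionsB G) (answersA G) (answersB G).
        perfect G p)"

section \<open>The hypergraph isomorphism game\<close>

datatype ('v, 'e, 'w, 'f) token = V1 'v | V2 'w | E1 'e | E2 'f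

definition tokens ::
    "('v, 'e) hypergraph \<Rightarrow> ('w, 'f) hypergraph \<Rightarrow> ('v, 'e, 'w, 'f) token set" where
  "tokens \<Lambda>1 \<Lambda>2 =
     V1 ` verts \<Lambda>1 \<union> V2 ` verts \<Lambda>2 \<union> E1 ` hedges \<Lambda>1 \<union> E2 ` hedges \<Lambda>2"

definition type_rule ::
    "('v, 'e) hypergraph \<Rightarrow> ('w, 'f) hypergraph \<Rightarrow>
     ('v, 'e, 'w, 'f) token \<Rightarrow> ('v, 'e, 'w, 'f) token \<Rightarrow> bool" where
  "type_rule \<Lambda>1 \<Lambda>2 x a \<longleftrightarrow>
     (x \<in> V1 ` verts \<Lambda>1 \<longrightarrow> a \<in> V2 ` verts \<Lambda>2) \<and>
     (x \<in> V2 ` verts \<Lambda>2 \<longrightarrow> a \<in> V1 ` verts \<Lambda>1) \<and>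
     (x \<in> E1 ` hedges \<Lambda>1 \<longrightarrow> a \<in> E2 ` hedges \<Lambda>2) \<and>
     (x \<in> E2 ` hedges \<Lambda>2 \<longrightarrow> a \<in> E1 ` hedges \<Lambda>1)"

definition incidence_rule ::
    "('v, 'e) hypergraph \<Rightarrow> ('w, 'f) hypergraph \<Rightarrow>
     ('v, 'e, 'w, 'f) token \<Rightarrow> ('v, 'e, 'w, 'f) token \<Rightarrow>
     ('v, 'e, 'w, 'f) token \<Rightarrow> ('v, 'e, 'w, 'f) token \<Rightarrow> bool" where
  "incidence_rule \<Lambda>1 \<Lambda>2 x y a b \<longleftrightarrow>
     (\<forall>v e w f. x = V1 v \<and> y = E1 e \<and> a = V2 w \<and> b = E2 f \<longrightarrow>
        (v \<in> inc \<Lambda>1 e \<longleftrightarrow> w \<in> inc \<Lambda>2 f)) \<and>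
     (\<forall>v e w f. x = V2 w \<and> y = E2 f \<and> a = V1 v \<and> b = E1 e \<longrightarrow>
        (w \<in> inc \<Lambda>2 f \<longleftrightarrow> v \<in> inc \<Lambda>1 e))"

definition vertex_rule ::
    "('v, 'e) hypergraph \<Rightarrow> ('w, 'f) hypergraph \<Rightarrow>
     ('v, 'e, 'w, 'f) token \<Rightarrow> ('v, 'e, 'w, 'f) token \<Rightarrow>
     ('v, 'e, 'w, 'f) token \<Rightarrow> ('v, 'e, 'w, 'f) token \<Rightarrow> bool" where
  "vertex_rule \<Lambda>1 \<Lambda>2 x y a b \<longleftrightarrow>
     (\<forall>vA wA vB wB. {x, a} = {V1 vA, V2 wA} \<and> {y, b} = {V1 vB, V2 wB} \<longrightarrow>
        vertex_rel \<Lambda>1 vA vB = vertex_rel \<Lambda>2 wA wB)"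

definition edge_rule ::
    "('v, 'e) hypergraph \<Rightarrow> ('w, 'f) hypergraph \<Rightarrow>
     ('v, 'e, 'w, 'f) token \<Rightarrow> ('v, 'e, 'w, 'f) token \<Rightarrow>
     ('v, 'e, 'w, 'f) token \<Rightarrow> ('v, 'e, 'w, 'f) token \<Rightarrow> bool" where
  "edge_rule \<Lambda>1 \<Lambda>2 x y a b \<longleftrightarrow>
     (\<forall>eA fA eB fB. {x, a} = {E1 eA, E2 fA} \<and> {y, b} = {E1 eB, E2 fB} \<longrightarrow>
        edge_rel \<Lambda>1 eA eB = edge_rel \<Lambda>2 fA fB)"

text \<open>In the presence of \<^const>\<open>type_rule\<close>, the answers automatically have the form that the
  premises of the other three rules require.\<close>

definition HypIso ::
    "('v, 'e) hypergraph \<Rightarrow> ('w, 'f) hypergraph \<Rightarrow>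
     (('v, 'e, 'w, 'f) token, ('v, 'e, 'w, 'f) token,
      ('v, 'e, 'w, 'f) token, ('v, 'e, 'w, 'f) token) game" where
  "HypIso \<Lambda>1 \<Lambda>2 =
     \<lparr> questionsA = tokens \<Lambda>1 \<Lambda>2, questionsB = tokens \<Lambda>1 \<Lambda>2,
       answersA = tokens \<Lambda>1 \<Lambda>2, answersB = tokens \<Lambda>1 \<Lambda>2,
       rule_fun = (\<lambda>x y a b.
         type_rule \<Lambda>1 \<Lambda>2 x a \<and> type_rule \<Lambda>1 \<Lambda>2 y b \<and>
         incidence_rule \<Lambda>1 \<Lambda>2 x y a b \<and>
         vertex_rule \<Lambda>1 \<Lambda>2 x y a b \<and>
         edge_rule \<Lambda>1 \<Lambda>2 x y a b) \<rparr>"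

definition q_isomorphic :: "('v, 'e) hypergraph \<Rightarrow> ('w, 'f) hypergraph \<Rightarrow> bool" where
  "q_isomorphic \<Lambda>1 \<Lambda>2 \<longleftrightarrow> has_perfect_quantum_strategy (HypIso \<Lambda>1 \<Lambda>2)"

definition loc_isomorphic :: "('v, 'e) hypergraph \<Rightarrow> ('w, 'f) hypergraph \<Rightarrow> bool" where
  "loc_isomorphic \<Lambda>1 \<Lambda>2 \<longleftrightarrow> has_perfect_local_strategy (HypIso \<Lambda>1 \<Lambda>2)"

end

theory Submission
  imports Defs
begin

text \<open>
  The construction starts from the Mermin-Peres magic square, a system of linear equations over the
  two-element field that has no solution but has a quantum solution.  To a system with right-hand
  side \<open>b\<close> belongs the hypergraph whose vertices are the pairs of a variable and a value, with
  one hyperedge for the two values of each variable, and one hyperedge for every equation and every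
  solution of this single equation.  The two hypergraphs of the theorem come from the homogeneous
  system and from the magic square system on the same variables and equations.

  There is no perfect local strategy: such a strategy contains a deterministic one, and this is an
  isomorphism of hypergraphs (\<open>loc_isomorphic_imp_isomorphism\<close>).  The all-zero assignment solves
  the homogeneous system; it shows in the hypergraph as a set of vertices that contains one value of
  each variable and one hyperedge of each equation.  The image of this set under an isomorphism
  would be a solution of the second system (\<open>isomorphism_imp_solution\<close>), and there is none
  (\<open>magic_square_no_solution\<close>).

  There is a perfect quantum strategy: if the second system had a solution, adding it to the values
  would be an isomorphism.  The players instead add the outcome of a measurement.  For a vertex they
  measure the observable of its variable; for the hyperedge of an equation they jointly measure the
  observables of that equation, which commute and whose product relation forces the outcomes to
  solve the equation (\<open>quantum_solution_from_observables\<close>).  With a shared maximally entangled state,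
  answers with orthogonal projections never occur together
  (\<open>perfect_quantum_strategy_from_pvms\<close>).  Outcomes that differ on a common variable have orthogonal
  projections; so on the variables that two questions have in common, both answers arise from the
  same shift of the values, and such shifts preserve all relations
  (\<open>quantum_solution_imp_quantum_isomorphism\<close>).
\<close>

section \<open>Projections and projection-valued measures\<close>

definition projection :: "nat \<Rightarrow> complex mat \<Rightarrow> bool" where
  "projection d M \<longleftrightarrow> M \<in> carrier_mat d d \<and> M * M = M \<and>
     (\<forall>i<d. \<forall>j<d. M $$ (j, i) = cnj (M $$ (i, j)))"

definition pvm :: "nat \<Rightarrow> 'a set \<Rightarrow> ('a \<Rightarrow> complex mat) \<Rightarrow> bool" where
  "pvm d A M \<longleftrightarrow> (\<forall>a\<in>A. projection d (M a)) \<and> mat d d (\<lambda>ij. \<Sum>a\<in>A. M a $$ ij) = 1\<^sub>m d"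

lemma projection_carrier: "projection d M \<Longrightarrow> M \<in> carrier_mat d d"
  by (simp add: projection_def)

lemma projection_idem: "projection d M \<Longrightarrow> M * M = M"
  by (simp add: projection_def)

lemma projection_herm: "projection d M \<Longrightarrow> i < d \<Longrightarrow> j < d \<Longrightarrow> cnj (M $$ (i, j)) = M $$ (j, i)"
  unfolding projection_def by metis

lemma projectionI:
  assumes "M \<in> carrier_mat d d" "M * M = M"
    and "\<And>i j. i < d \<Longrightarrow> j < d \<Longrightarrow> M $$ (j, i) = cnj (M $$ (i, j))"
  shows "projection d M"
  using assms unfolding projection_def by blast

lemma projection_zero: "projection d (0\<^sub>m d d)"
  by (auto simp: projection_def)

lemma projection_one: "projection d (1\<^sub>m d)"
  by (auto simp: projection_def)

lemmas mat_assoc = assoc_mult_mat[of _ d d _ d _ d] for d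

lemmas mat_closed = mult_carrier_mat[of _ d d _ d] for d

lemma projection_transpose:
  assumes "projection d M"
  shows "projection d (transpose_mat M)"
proof -
  have M: "M \<in> carrier_mat d d" using assms by (rule projection_carrier)
  have "transpose_mat M * transpose_mat M = transpose_mat (M * M)"
    using transpose_mult[OF M M] by simp
  then have "transpose_mat M * transpose_mat M = transpose_mat M"
    by (simp add: projection_idem[OF assms])
  then show ?thesis
    by (rule projectionI[rotated]) (use M in \<open>auto simp: projection_herm[OF assms]\<close>)
qed

lemma mat_mult_entry:
  assumes "M \<in> carrier_mat d d" "N \<in> carrier_mat d d" "i < d" "j < d"
  shows "(M * N) $$ (i, j) = (\<Sum>k<d. M $$ (i, k) * N $$ (k, j))"
  using assms by (auto simp: scalar_prod_def atLeast0LessThan intro!: sum.cong)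

lemma projection_mult_eq_zero_commute:
  assumes M: "projection d M" and N: "projection d N" and z: "M * N = 0\<^sub>m d d"
  shows "N * M = 0\<^sub>m d d"
proof (rule eq_matI)
  note c = projection_carrier[OF M] projection_carrier[OF N]
  fix i j assume "i < dim_row (0\<^sub>m d d :: complex mat)" "j < dim_col (0\<^sub>m d d :: complex mat)"
  then have ij: "i < d" "j < d" by auto
  have "(N * M) $$ (i, j) = (\<Sum>k<d. cnj (M $$ (j, k) * N $$ (k, i)))"
    unfolding mat_mult_entry[OF c(2,1) ij] using ij
    by (auto intro!: sum.cong simp: projection_herm[OF M] projection_herm[OF N])
  also have "\<dots> = cnj ((M * N) $$ (j, i))"
    unfolding mat_mult_entry[OF c ij(2,1)] by simp
  finally show "(N * M) $$ (i, j) = 0\<^sub>m d d $$ (i, j)" using ij z by simp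
qed (use projection_carrier[OF M] projection_carrier[OF N] in auto)

lemma projection_mult_commuting:
  assumes M: "projection d M" and N: "projection d N" and comm: "M * N = N * M"
  shows "projection d (M * N)"
proof -
  note c = projection_carrier[OF M] projection_carrier[OF N]
  have "(M * N) * (M * N) = M * (N * (M * N))" using c by (simp add: mat_assoc[where d = d] mat_closed[where d = d])
  also have "N * (M * N) = (N * M) * N" using c by (simp add: mat_assoc[where d = d] mat_closed[where d = d])
  also have "(N * M) * N = (M * N) * N" by (simp add: comm)
  also have "\<dots> = M * (N * N)" using c by (simp add: mat_assoc[where d = d] mat_closed[where d = d])
  also have "M * (M * (N * N)) = (M * M) * (N * N)" using c by (simp add: mat_assoc[where d = d] mat_closed[where d = d])
  finally have idem: "(M * N) * (M * N) = M * N"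
    using M N by (simp add: projection_idem)
  have "(M * N) $$ (j, i) = cnj ((M * N) $$ (i, j))" if ij: "i < d" "j < d" for i j
  proof -
    have "(M * N) $$ (j, i) = (N * M) $$ (j, i)" by (simp add: comm)
    also have "\<dots> = (\<Sum>k<d. cnj (M $$ (i, k) * N $$ (k, j)))"
      unfolding mat_mult_entry[OF c(2,1) ij(2,1)] using ij
      by (auto intro!: sum.cong simp: projection_herm[OF M] projection_herm[OF N])
    also have "\<dots> = cnj ((M * N) $$ (i, j))"
      unfolding mat_mult_entry[OF c ij] by simp
    finally show ?thesis .
  qed
  with idem mult_carrier_mat[OF c] show ?thesis by (intro projectionI)
qed

text \<open>The inner product \<open>\<langle>M v, v\<rangle>\<close> equals \<open>\<parallel>M v\<parallel>\<^sup>2\<close>.\<close>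
lemma projection_positive:
  assumes M: "projection d M"
  shows "positive_op d M"
proof -
  note c = projection_carrier[OF M]
  have "0 \<le> (M *\<^sub>v v) \<bullet>c v" if v: "v \<in> carrier_vec d" for v
  proof -
    define w where "w = M *\<^sub>v v"
    have w: "w \<in> carrier_vec d" using c v by (simp add: w_def)
    have wi: "w $ i = (\<Sum>k<d. M $$ (i, k) * v $ k)" if "i < d" for i
      using that c v by (auto simp: w_def scalar_prod_def atLeast0LessThan intro!: sum.cong)
    have "M *\<^sub>v w = w" using c v M by (simp add: w_def projection_idem flip: assoc_mult_mat_vec)
    then have "w \<bullet>c v = (M *\<^sub>v w) \<bullet>c v" by simp
    also have "\<dots> = (\<Sum>i<d. \<Sum>k<d. M $$ (i, k) * w $ k * cnj (v $ i))"
      using c v w by (auto simp: scalar_prod_def atLeast0LessThan sum_distrib_right intro!: sum.cong)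
    also have "\<dots> = (\<Sum>k<d. \<Sum>i<d. w $ k * cnj (M $$ (k, i) * v $ i))"
      by (subst sum.swap) (auto intro!: sum.cong simp: projection_herm[OF M])
    also have "\<dots> = (\<Sum>k<d. w $ k * cnj (w $ k))"
      by (auto simp: wi sum_distrib_left intro!: sum.cong)
    also have "0 \<le> \<dots>"
      by (rule sum_nonneg) (simp add: less_eq_complex_def)
    finally show ?thesis by (simp add: w_def)
  qed
  with c show ?thesis by (simp add: positive_op_def)
qed

lemma pvm_projection: "pvm d A M \<Longrightarrow> a \<in> A \<Longrightarrow> projection d (M a)"
  by (simp add: pvm_def)

lemma pvm_sum:
  assumes "pvm d A M" "i < d" "j < d"
  shows "(\<Sum>a\<in>A. M a $$ (i, j)) = (if i = j then 1 else 0)"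
proof -
  have "(\<Sum>a\<in>A. M a $$ (i, j)) = mat d d (\<lambda>ij. \<Sum>a\<in>A. M a $$ ij) $$ (i, j)"
    using assms by simp
  also have "\<dots> = (1\<^sub>m d :: complex mat) $$ (i, j)" using assms(1) by (simp add: pvm_def)
  finally show ?thesis using assms by simp
qed

lemma pvmI:
  assumes "\<And>a. a \<in> A \<Longrightarrow> projection d (M a)"
    and "\<And>i j. i < d \<Longrightarrow> j < d \<Longrightarrow> (\<Sum>a\<in>A. M a $$ (i, j)) = (if i = j then 1 else 0)"
  shows "pvm d A M"
  unfolding pvm_def using assms by (auto intro!: eq_matI)

lemma pvm_transpose: "pvm d A M \<Longrightarrow> pvm d A (\<lambda>a. transpose_mat (M a))"
proof (rule pvmI)
  assume M: "pvm d A M"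
  show "projection d (transpose_mat (M a))" if "a \<in> A" for a
    using projection_transpose[OF pvm_projection[OF M that]] .
  show "(\<Sum>a\<in>A. transpose_mat (M a) $$ (i, j)) = (if i = j then 1 else 0)" if "i < d" "j < d" for i j
  proof -
    have "(\<Sum>a\<in>A. transpose_mat (M a) $$ (i, j)) = (\<Sum>a\<in>A. M a $$ (j, i))"
      using that projection_carrier[OF pvm_projection[OF M]]
      by (intro sum.cong refl) (simp add: carrier_matD[of _ d d])
    then show ?thesis using pvm_sum[OF M that(2,1)] by auto
  qed
qed

lemma pvm_imp_povm: "pvm d A M \<Longrightarrow> povm d A M"
  by (simp add: pvm_def povm_def projection_positive)

lemma pvm_cong: "(\<And>a. a \<in> A \<Longrightarrow> M a = N a) \<Longrightarrow> pvm d A M \<longleftrightarrow> pvm d A N"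
  by (simp add: pvm_def cong: sum.cong)

lemma pvm_reindex:
  assumes g: "bij_betw g A B" and M: "pvm d B M"
  shows "pvm d A (\<lambda>a. M (g a))"
proof (rule pvmI)
  show "projection d (M (g a))" if "a \<in> A" for a
    using pvm_projection[OF M bij_betw_apply[OF g that]] .
  show "(\<Sum>a\<in>A. M (g a) $$ (i, j)) = (if i = j then 1 else 0)" if "i < d" "j < d" for i j
    using sum.reindex_bij_betw[OF g, of "\<lambda>b. M b $$ (i, j)"] pvm_sum[OF M that] by simp
qed

lemma pvm_extend_by_zero:
  assumes M: "pvm d B M" and "finite A" "B \<subseteq> A"
    and zero: "\<And>a. a \<in> A - B \<Longrightarrow> M a = 0\<^sub>m d d"
  shows "pvm d A M"
proof (rule pvmI)
  show "projection d (M a)" if "a \<in> A" for a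
    using that zero[of a] projection_zero pvm_projection[OF M, of a] by (cases "a \<in> B") auto
  show "(\<Sum>a\<in>A. M a $$ (i, j)) = (if i = j then 1 else 0)" if "i < d" "j < d" for i j
  proof -
    have "(\<Sum>a\<in>A. M a $$ (i, j)) = (\<Sum>a\<in>B. M a $$ (i, j))"
      using assms that by (intro sum.mono_neutral_right) auto
    then show ?thesis using pvm_sum[OF M that] by simp
  qed
qed

lemma pvm_singleton: "M a = 1\<^sub>m d \<Longrightarrow> pvm d {a} M"
  by (rule pvmI) (auto simp: projection_one)

text \<open>The identity, written as the sum of the operators \<open>M a\<close>, is inserted between \<open>E\<close>
  and \<open>F\<close>.\<close>
lemma mat_mult_via_pvm:
  assumes M: "pvm d A M" and E: "E \<in> carrier_mat d d" and F: "F \<in> carrier_mat d d"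
    and ij: "i < d" "j < d"
  shows "(E * F) $$ (i, j) = (\<Sum>a\<in>A. (E * M a * F) $$ (i, j))"
proof -
  have "(\<Sum>a\<in>A. (E * M a * F) $$ (i, j)) =
      (\<Sum>a\<in>A. \<Sum>l<d. \<Sum>k<d. E $$ (i, k) * M a $$ (k, l) * F $$ (l, j))"
  proof (rule sum.cong[OF refl])
    fix a assume a: "a \<in> A"
    note c = projection_carrier[OF pvm_projection[OF M a]]
    show "(E * M a * F) $$ (i, j) = (\<Sum>l<d. \<Sum>k<d. E $$ (i, k) * M a $$ (k, l) * F $$ (l, j))"
      unfolding mat_mult_entry[OF mult_carrier_mat[OF E c] F ij]
      by (intro sum.cong refl)
        (simp add: mat_mult_entry[OF E c] ij sum_distrib_right del: index_mult_mat)
  qed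
  also have "\<dots> = (\<Sum>l<d. \<Sum>k<d. \<Sum>a\<in>A. E $$ (i, k) * M a $$ (k, l) * F $$ (l, j))"
    by (simp only: sum.swap[where A = A])
  also have "\<dots> = (\<Sum>l<d. \<Sum>k<d. E $$ (i, k) * (\<Sum>a\<in>A. M a $$ (k, l)) * F $$ (l, j))"
    by (simp add: sum_distrib_left sum_distrib_right)
  also have "\<dots> = (\<Sum>l<d. \<Sum>k<d. if k = l then E $$ (i, k) * F $$ (l, j) else 0)"
    by (intro sum.cong refl) (simp add: pvm_sum[OF M])
  also have "\<dots> = (E * F) $$ (i, j)"
    unfolding mat_mult_entry[OF E F ij] by (intro sum.cong refl) simp
  finally show ?thesis ..
qed

lemma mult_eq_zero_via_pvm:
  assumes M: "pvm d A M" and E: "E \<in> carrier_mat d d" and F: "F \<in> carrier_mat d d"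
    and zero: "\<And>a. a \<in> A \<Longrightarrow> E * M a * F = 0\<^sub>m d d"
  shows "E * F = 0\<^sub>m d d"
proof (rule eq_matI)
  fix i j assume "i < dim_row (0\<^sub>m d d :: complex mat)" "j < dim_col (0\<^sub>m d d :: complex mat)"
  then have ij: "i < d" "j < d" by auto
  show "(E * F) $$ (i, j) = 0\<^sub>m d d $$ (i, j)"
    unfolding mat_mult_via_pvm[OF M E F ij] by (subst sum.cong[OF refl]) (use zero ij in auto)
qed (use E F in auto)

lemma pvm_product:
  assumes M: "pvm d A M" and N: "pvm d B N"
    and comm: "\<And>a b. a \<in> A \<Longrightarrow> b \<in> B \<Longrightarrow> M a * N b = N b * M a"
  shows "pvm d (A \<times> B) (\<lambda>(a, b). M a * N b)"
proof (rule pvmI)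
  show "projection d (case ab of (a, b) \<Rightarrow> M a * N b)" if "ab \<in> A \<times> B" for ab
    using that by (cases ab)
      (simp add: projection_mult_commuting[OF pvm_projection[OF M] pvm_projection[OF N] comm])
  fix i j assume ij: "i < d" "j < d"
  have one: "M a * N b = 1\<^sub>m d * M a * N b" if "a \<in> A" for a b
    using projection_carrier[OF pvm_projection[OF M that]] by simp
  have "(\<Sum>ab\<in>A \<times> B. (case ab of (a, b) \<Rightarrow> M a * N b) $$ (i, j)) =
      (\<Sum>a\<in>A. \<Sum>b\<in>B. (M a * N b) $$ (i, j))"
    by (simp add: sum.cartesian_product case_prod_unfold)
  also have "\<dots> = (\<Sum>b\<in>B. \<Sum>a\<in>A. (1\<^sub>m d * M a * N b) $$ (i, j))"
    by (subst sum.swap, intro sum.cong refl) (simp only: one)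
  also have "\<dots> = (\<Sum>b\<in>B. (1\<^sub>m d * N b) $$ (i, j))"
  proof (rule sum.cong[OF refl])
    fix b assume b: "b \<in> B"
    from mat_mult_via_pvm[OF M one_carrier_mat projection_carrier[OF pvm_projection[OF N b]] ij]
    show "(\<Sum>a\<in>A. (1\<^sub>m d * M a * N b) $$ (i, j)) = (1\<^sub>m d * N b) $$ (i, j)" by simp
  qed
  also have "\<dots> = (\<Sum>b\<in>B. N b $$ (i, j))"
    by (intro sum.cong refl) (simp only: left_mult_one_mat[OF projection_carrier[OF pvm_projection[OF N]]])
  finally show "(\<Sum>ab\<in>A \<times> B. (case ab of (a, b) \<Rightarrow> M a * N b) $$ (i, j)) = (if i = j then 1 else 0)"
    using pvm_sum[OF N ij] by simp
qed

section \<open>Correlations from the maximally entangled state\<close>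

text \<open>The vector \<open>(1 / \<surd>d) \<Sum>\<^sub>i e\<^sub>i \<otimes> e\<^sub>i\<close>, with the indexing of the tensor product
  that \<^const>\<open>kron\<close> uses.\<close>
definition max_entangled :: "nat \<Rightarrow> complex vec" where
  "max_entangled d = vec (d * d) (\<lambda>t. if t div d = t mod d then complex_of_real (1 / sqrt d) else 0)"

lemma sum_div_mod:
  fixes g :: "nat \<Rightarrow> nat \<Rightarrow> complex"
  assumes "d > 0"
  shows "(\<Sum>t<d * d. g (t div d) (t mod d)) = (\<Sum>i<d. \<Sum>k<d. g i k)"
proof -
  have "(\<Sum>t<d * d. g (t div d) (t mod d)) = (\<Sum>(i, k)\<in>{..<d} \<times> {..<d}. g i k)"
  proof (rule sum.reindex_bij_witness[where i = "\<lambda>(i, k). i * d + k" and j = "\<lambda>t. (t div d, t mod d)"])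
    fix ik assume "ik \<in> {..<d} \<times> {..<d}"
    then obtain i k where ik: "ik = (i, k)" "i < d" "k < d" by auto
    have "i * d + k < Suc i * d" using ik by simp
    also have "\<dots> \<le> d * d" using ik by (intro mult_le_mono1) simp
    finally show "(case ik of (i, k) \<Rightarrow> i * d + k) \<in> {..<d * d}" using ik by simp
  qed (use assms in \<open>auto simp: less_mult_imp_div_less\<close>)
  then show ?thesis by (simp add: sum.cartesian_product)
qed

lemma sum_div_mod_diagonal:
  fixes g :: "nat \<Rightarrow> complex"
  assumes "d > 0"
  shows "(\<Sum>t<d * d. if t div d = t mod d then g (t mod d) else 0) = (\<Sum>i<d. g i)"
proof -
  have "(\<Sum>t<d * d. if t div d = t mod d then g (t mod d) else 0) =
      (\<Sum>i<d. \<Sum>k<d. if i = k then g k else 0)"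
    using sum_div_mod[OF assms, of "\<lambda>i k. if i = k then g k else 0"] by simp
  then show ?thesis by simp
qed

lemma max_entangled_norm:
  assumes "d > 0"
  shows "max_entangled d \<bullet>c max_entangled d = 1"
proof -
  have "max_entangled d \<bullet>c max_entangled d =
      (\<Sum>t<d * d. if t div d = t mod d then complex_of_real (1 / sqrt d * (1 / sqrt d)) else 0)"
    by (auto simp: max_entangled_def scalar_prod_def atLeast0LessThan simp flip: of_real_mult
        intro!: sum.cong)
  also have "\<dots> = (\<Sum>i<d. complex_of_real (1 / sqrt d * (1 / sqrt d)))"
    by (rule sum_div_mod_diagonal[OF assms])
  also have "\<dots> = complex_of_real (\<Sum>i<d. 1 / d)"
    by (simp flip: of_real_mult)
  also have "\<dots> = 1" using assms by simp
  finally show ?thesis .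
qed

text \<open>In the maximally entangled state the joint expectation of \<open>M\<close> and \<open>N\<close> is the trace of
  \<open>M N\<^sup>T\<close> divided by \<open>d\<close>.  The transpose is why Bob measures transposed operators below.\<close>
lemma max_entangled_kron:
  assumes "d > 0" and M: "M \<in> carrier_mat d d" and N: "N \<in> carrier_mat d d"
  shows "(kron M N *\<^sub>v max_entangled d) \<bullet>c max_entangled d =
    (\<Sum>i<d. \<Sum>k<d. M $$ (i, k) * N $$ (i, k)) / d"
proof -
  let ?r = "complex_of_real (1 / sqrt d)"
  have rr: "?r * ?r = 1 / d" by (simp flip: of_real_mult)
  have "(kron M N *\<^sub>v max_entangled d) $ s =
      (\<Sum>k<d. ?r * (M $$ (s div d, k) * N $$ (s mod d, k)))" if s: "s < d * d" for s
  proof -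
    have "(kron M N *\<^sub>v max_entangled d) $ s = (\<Sum>t<d * d. if t div d = t mod d
        then ?r * (M $$ (s div d, t mod d) * N $$ (s mod d, t mod d)) else 0)"
      using s M N
      by (auto simp: kron_def max_entangled_def scalar_prod_def atLeast0LessThan intro!: sum.cong)
    also have "\<dots> = (\<Sum>k<d. ?r * (M $$ (s div d, k) * N $$ (s mod d, k)))"
      by (rule sum_div_mod_diagonal[OF assms(1)])
    finally show ?thesis .
  qed
  then have "(kron M N *\<^sub>v max_entangled d) \<bullet>c max_entangled d =
      (\<Sum>s<d * d. if s div d = s mod d
        then (\<Sum>k<d. ?r * (M $$ (s mod d, k) * N $$ (s mod d, k))) * ?r else 0)"
    using M N by (auto simp: kron_def max_entangled_def scalar_prod_def atLeast0LessThan
        simp del: index_mult_mat_vec intro!: sum.cong)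
  also have "\<dots> = (\<Sum>i<d. (\<Sum>k<d. ?r * (M $$ (i, k) * N $$ (i, k))) * ?r)"
    by (rule sum_div_mod_diagonal[OF assms(1)])
  also have "\<dots> = (\<Sum>i<d. \<Sum>k<d. (?r * ?r) * (M $$ (i, k) * N $$ (i, k)))"
    by (simp add: sum_distrib_right sum_distrib_left mult_ac)
  also have "\<dots> = (\<Sum>i<d. \<Sum>k<d. M $$ (i, k) * N $$ (i, k)) / d"
    unfolding rr by (simp add: sum_divide_distrib)
  finally show ?thesis .
qed

text \<open>The square of the Hilbert-Schmidt norm.\<close>
definition hs_norm2 :: "nat \<Rightarrow> complex mat \<Rightarrow> real" where
  "hs_norm2 d M = (\<Sum>i<d. \<Sum>j<d. (cmod (M $$ (i, j)))\<^sup>2)"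

text \<open>Both sides are the trace of \<open>E F\<close>: the left side is \<open>tr (E F (E F)\<^sup>*) = tr (E F F E)\<close>,
  and idempotence and cyclicity of the trace reduce this to \<open>tr (E F)\<close>.  Writing the
  probabilities as norms makes two things evident: they are non-negative, and they vanish when
  \<open>E F = 0\<close>.\<close>
lemma hs_norm2_projection_mult:
  assumes E: "projection d E" and F: "projection d F"
  shows "complex_of_real (hs_norm2 d (E * F)) = (\<Sum>i<d. \<Sum>k<d. E $$ (i, k) * F $$ (k, i))"
proof -
  note c = projection_carrier[OF E] projection_carrier[OF F]
  have FE: "cnj ((E * F) $$ (i, j)) = (F * E) $$ (j, i)" if "i < d" "j < d" for i j
    unfolding mat_mult_entry[OF c that] mat_mult_entry[OF c(2,1) that(2,1)] cnj_sum
    using that by (auto intro!: sum.cong simp: projection_herm[OF E] projection_herm[OF F])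
  have "complex_of_real (hs_norm2 d (E * F)) =
      (\<Sum>i<d. \<Sum>j<d. (E * F) $$ (i, j) * (F * E) $$ (j, i))"
    unfolding hs_norm2_def of_real_sum complex_norm_square
    by (intro sum.cong refl) (simp add: FE del: index_mult_mat)
  also have "\<dots> = (\<Sum>i<d. ((E * F) * (F * E)) $$ (i, i))"
    by (intro sum.cong refl)
      (simp add: mat_mult_entry[OF mult_carrier_mat[OF c] mult_carrier_mat[OF c(2,1)]] del: index_mult_mat)
  also have "(E * F) * (F * E) = (E * F) * E"
  proof -
    have "(E * F) * (F * E) = (E * (F * F)) * E"
      using c by (simp add: mat_assoc[where d = d] mat_closed[where d = d])
    then show ?thesis by (simp add: projection_idem[OF F])
  qed
  also have "(\<Sum>i<d. ((E * F) * E) $$ (i, i)) = (\<Sum>i<d. \<Sum>k<d. (E * F) $$ (i, k) * E $$ (k, i))"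
    by (intro sum.cong refl) (simp add: mat_mult_entry[OF mult_carrier_mat[OF c] c(1)] del: index_mult_mat)
  also have "\<dots> = (\<Sum>k<d. \<Sum>i<d. E $$ (k, i) * (E * F) $$ (i, k))"
    by (subst sum.swap) (simp add: mult.commute)
  also have "\<dots> = (\<Sum>k<d. (E * (E * F)) $$ (k, k))"
    by (intro sum.cong refl) (simp add: mat_mult_entry[OF c(1) mult_carrier_mat[OF c]] del: index_mult_mat)
  also have "E * (E * F) = E * F"
    using c by (simp add: projection_idem[OF E] flip: mat_assoc[where d = d])
  also have "(\<Sum>k<d. (E * F) $$ (k, k)) = (\<Sum>i<d. \<Sum>k<d. E $$ (i, k) * F $$ (k, i))"
    by (intro sum.cong refl) (simp add: mat_mult_entry[OF c] del: index_mult_mat)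
  finally show ?thesis .
qed

lemma hs_norm2_product_sum:
  assumes E: "pvm d A E" and F: "pvm d B F"
  shows "(\<Sum>a\<in>A. \<Sum>b\<in>B. hs_norm2 d (E a * F b)) = d"
proof -
  have "complex_of_real (\<Sum>a\<in>A. \<Sum>b\<in>B. hs_norm2 d (E a * F b)) =
      (\<Sum>a\<in>A. \<Sum>b\<in>B. \<Sum>i<d. \<Sum>k<d. E a $$ (i, k) * F b $$ (k, i))"
    unfolding of_real_sum
    by (intro sum.cong refl hs_norm2_projection_mult pvm_projection[OF E] pvm_projection[OF F])
  also have "\<dots> = (\<Sum>i<d. \<Sum>k<d. \<Sum>a\<in>A. \<Sum>b\<in>B. E a $$ (i, k) * F b $$ (k, i))"
    by (simp only: sum.swap[where A = B and B = "{..<d}"] sum.swap[where A = A and B = "{..<d}"])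
  also have "\<dots> = (\<Sum>i<d. \<Sum>k<d. (\<Sum>a\<in>A. E a $$ (i, k)) * (\<Sum>b\<in>B. F b $$ (k, i)))"
    by (simp add: sum_product)
  also have "\<dots> = (\<Sum>i<d. \<Sum>k<d. if i = k then 1 else 0)"
    by (intro sum.cong refl) (simp add: pvm_sum[OF E] pvm_sum[OF F])
  also have "\<dots> = complex_of_real (real d)" by simp
  finally show ?thesis using of_real_eq_iff by blast
qed

text \<open>A perfect quantum strategy thus reduces to operator algebra: it suffices that the
  projections belonging to a losing combination multiply to zero.  The strategy lets Alice measure
  \<open>E x\<close> and Bob the transpose of \<open>F y\<close> on the maximally entangled state, which gives
  the probability \<open>tr (E x a * F y b) / d\<close>.\<close>
lemma perfect_quantum_strategy_from_pvms:
  assumes d: "d > 0"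
    and E: "\<And>x. x \<in> questionsA G \<Longrightarrow> pvm d (answersA G) (E x)"
    and F: "\<And>y. y \<in> questionsB G \<Longrightarrow> pvm d (answersB G) (F y)"
    and orth: "\<And>x y a b. \<lbrakk>x \<in> questionsA G; y \<in> questionsB G; a \<in> answersA G; b \<in> answersB G;
        \<not> rule_fun G x y a b\<rbrakk> \<Longrightarrow> E x a * F y b = 0\<^sub>m d d"
  shows "has_perfect_quantum_strategy G"
proof -
  define p where "p x y a b = hs_norm2 d (E x a * F y b) / d" for x y a b
  have "correlation (questionsA G) (questionsB G) (answersA G) (answersB G) p"
    unfolding correlation_def prob_dist_def
  proof (intro ballI conjI)
    fix x y assume x: "x \<in> questionsA G" and y: "y \<in> questionsB G"
    show "0 \<le> (case ab of (a, b) \<Rightarrow> p x y a b)" for ab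
      by (auto simp: p_def hs_norm2_def split: prod.split intro!: divide_nonneg_nonneg sum_nonneg)
    have "(\<Sum>ab\<in>answersA G \<times> answersB G. case ab of (a, b) \<Rightarrow> p x y a b) =
        (\<Sum>a\<in>answersA G. \<Sum>b\<in>answersB G. hs_norm2 d (E x a * F y b)) / d"
      by (simp add: p_def sum.cartesian_product sum_divide_distrib case_prod_unfold)
    then show "(\<Sum>ab\<in>answersA G \<times> answersB G. case ab of (a, b) \<Rightarrow> p x y a b) = 1"
      using hs_norm2_product_sum[OF E[OF x] F[OF y]] d by simp
  qed
  moreover have "complex_of_real (p x y a b) =
      (kron (E x a) (transpose_mat (F y b)) *\<^sub>v max_entangled d) \<bullet>c max_entangled d"
    if "x \<in> questionsA G" "y \<in> questionsB G" "a \<in> answersA G" "b \<in> answersB G" for x y a b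
  proof -
    have Ea: "projection d (E x a)" and Fb: "projection d (F y b)"
      by (rule pvm_projection[OF E[OF that(1)] that(3)], rule pvm_projection[OF F[OF that(2)] that(4)])
    note c = projection_carrier[OF Ea] projection_carrier[OF Fb]
    have "(\<Sum>i<d. \<Sum>k<d. E x a $$ (i, k) * transpose_mat (F y b) $$ (i, k)) =
        (\<Sum>i<d. \<Sum>k<d. E x a $$ (i, k) * F y b $$ (k, i))"
      using c by (intro sum.cong refl) auto
    then show ?thesis
      using c unfolding max_entangled_kron[OF d c(1) transpose_carrier_mat[THEN iffD2, OF c(2)]]
      by (simp add: p_def hs_norm2_projection_mult[OF Ea Fb])
  qed
  moreover have "max_entangled d \<in> carrier_vec (d * d)" by (simp add: max_entangled_def)
  ultimately have "p \<in> quantum_correlations (questionsA G) (questionsB G) (answersA G) (answersB G)"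
    unfolding quantum_correlations_def
    using max_entangled_norm[OF d] pvm_imp_povm[OF E] pvm_imp_povm[OF pvm_transpose[OF F]]
    by (intro CollectI conjI exI[of _ d] exI[of _ "max_entangled d"] exI[of _ E]
        exI[of _ "\<lambda>y b. transpose_mat (F y b)"] ballI) auto
  moreover have "perfect G p"
    unfolding perfect_def p_def by (auto simp: orth hs_norm2_def)
  ultimately show ?thesis unfolding has_perfect_quantum_strategy_def by blast
qed

section \<open>Quantum isomorphisms of hypergraphs\<close>

text \<open>The pair \<open>(U, W)\<close> is a quantum version of the permutation matrices of a vertex bijection
  and a hyperedge bijection: the entries are projections, each row and each column sums to the
  identity, and entries that no common isomorphism allows are orthogonal.\<close>
definition quantum_isomorphism ::
    "nat \<Rightarrow> ('v, 'e) hypergraph \<Rightarrow> ('w, 'f) hypergraph \<Rightarrow>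
     ('v \<Rightarrow> 'w \<Rightarrow> complex mat) \<Rightarrow> ('e \<Rightarrow> 'f \<Rightarrow> complex mat) \<Rightarrow> bool" where
  "quantum_isomorphism d \<Lambda>1 \<Lambda>2 U W \<longleftrightarrow>
     (\<forall>v\<in>verts \<Lambda>1. pvm d (verts \<Lambda>2) (U v)) \<and>
     (\<forall>w\<in>verts \<Lambda>2. pvm d (verts \<Lambda>1) (\<lambda>v. U v w)) \<and>
     (\<forall>e\<in>hedges \<Lambda>1. pvm d (hedges \<Lambda>2) (W e)) \<and>
     (\<forall>f\<in>hedges \<Lambda>2. pvm d (hedges \<Lambda>1) (\<lambda>e. W e f)) \<and>
     (\<forall>v\<in>verts \<Lambda>1. \<forall>w\<in>verts \<Lambda>2. \<forall>e\<in>hedges \<Lambda>1. \<forall>f\<in>hedges \<Lambda>2.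
        (v \<in> inc \<Lambda>1 e) \<noteq> (w \<in> inc \<Lambda>2 f) \<longrightarrow> U v w * W e f = 0\<^sub>m d d) \<and>
     (\<forall>v\<in>verts \<Lambda>1. \<forall>w\<in>verts \<Lambda>2. \<forall>v'\<in>verts \<Lambda>1. \<forall>w'\<in>verts \<Lambda>2.
        vertex_rel \<Lambda>1 v v' \<noteq> vertex_rel \<Lambda>2 w w' \<longrightarrow> U v w * U v' w' = 0\<^sub>m d d) \<and>
     (\<forall>e\<in>hedges \<Lambda>1. \<forall>f\<in>hedges \<Lambda>2. \<forall>e'\<in>hedges \<Lambda>1. \<forall>f'\<in>hedges \<Lambda>2.
        edge_rel \<Lambda>1 e e' \<noteq> edge_rel \<Lambda>2 f f' \<longrightarrow> W e f * W e' f' = 0\<^sub>m d d)"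

lemma quantum_isomorphismD:
  assumes "quantum_isomorphism d \<Lambda>1 \<Lambda>2 U W"
  shows "v \<in> verts \<Lambda>1 \<Longrightarrow> pvm d (verts \<Lambda>2) (U v)"
    and "w \<in> verts \<Lambda>2 \<Longrightarrow> pvm d (verts \<Lambda>1) (\<lambda>v. U v w)"
    and "e \<in> hedges \<Lambda>1 \<Longrightarrow> pvm d (hedges \<Lambda>2) (W e)"
    and "f \<in> hedges \<Lambda>2 \<Longrightarrow> pvm d (hedges \<Lambda>1) (\<lambda>e. W e f)"
    and "\<lbrakk>v \<in> verts \<Lambda>1; w \<in> verts \<Lambda>2; e \<in> hedges \<Lambda>1; f \<in> hedges \<Lambda>2;
        (v \<in> inc \<Lambda>1 e) \<noteq> (w \<in> inc \<Lambda>2 f)\<rbrakk> \<Longrightarrow> U v w * W e f = 0\<^sub>m d d"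
    and "\<lbrakk>v \<in> verts \<Lambda>1; w \<in> verts \<Lambda>2; v' \<in> verts \<Lambda>1; w' \<in> verts \<Lambda>2;
        vertex_rel \<Lambda>1 v v' \<noteq> vertex_rel \<Lambda>2 w w'\<rbrakk> \<Longrightarrow> U v w * U v' w' = 0\<^sub>m d d"
    and "\<lbrakk>e \<in> hedges \<Lambda>1; f \<in> hedges \<Lambda>2; e' \<in> hedges \<Lambda>1; f' \<in> hedges \<Lambda>2;
        edge_rel \<Lambda>1 e e' \<noteq> edge_rel \<Lambda>2 f f'\<rbrakk> \<Longrightarrow> W e f * W e' f' = 0\<^sub>m d d"
  using assms unfolding quantum_isomorphism_def by simp_all

text \<open>Questions about \<open>\<Lambda>1\<close> are answered by measuring a row of \<open>U\<close> or \<open>W\<close>, questions about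
  \<open>\<Lambda>2\<close> by measuring a column.  Since the rules for two vertices and for two hyperedges
  depend only on the unordered pairs of question and answer, one family of
  projections serves both kinds of question.\<close>
fun token_measurement ::
    "nat \<Rightarrow> ('v \<Rightarrow> 'w \<Rightarrow> complex mat) \<Rightarrow> ('e \<Rightarrow> 'f \<Rightarrow> complex mat) \<Rightarrow>
     ('v, 'e, 'w, 'f) token \<Rightarrow> ('v, 'e, 'w, 'f) token \<Rightarrow> complex mat" where
  "token_measurement d U W (V1 v) (V2 w) = U v w"
| "token_measurement d U W (V2 w) (V1 v) = U v w"
| "token_measurement d U W (E1 e) (E2 f) = W e f"
| "token_measurement d U W (E2 f) (E1 e) = W e f"
| "token_measurement d U W _ _ = 0\<^sub>m d d"

lemma finite_tokens: "is_hypergraph \<Lambda>1 \<Longrightarrow> is_hypergraph \<Lambda>2 \<Longrightarrow> finite (tokens \<Lambda>1 \<Lambda>2)"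
  by (simp add: is_hypergraph_def tokens_def)

lemma pvm_on_image:
  assumes M: "pvm d Z (\<lambda>z. M (c z))" and c: "inj c" and "finite T" and sub: "c ` Z \<subseteq> T"
    and zero: "\<And>a. a \<in> T - c ` Z \<Longrightarrow> M a = 0\<^sub>m d d"
  shows "pvm d T M"
proof (rule pvm_extend_by_zero[OF _ \<open>finite T\<close> sub zero])
  have "bij_betw (inv_into UNIV c) (c ` Z) Z"
    using c by (intro bij_betwI[where g = c]) auto
  from pvm_reindex[OF this M] show "pvm d (c ` Z) M"
    by (rule pvm_cong[THEN iffD1, rotated]) (use c in auto)
qed

lemma pvm_token_measurement:
  assumes "is_hypergraph \<Lambda>1" "is_hypergraph \<Lambda>2" and Q: "quantum_isomorphism d \<Lambda>1 \<Lambda>2 U W"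
    and x: "x \<in> tokens \<Lambda>1 \<Lambda>2"
  shows "pvm d (tokens \<Lambda>1 \<Lambda>2) (token_measurement d U W x)"
proof -
  note main = pvm_on_image[where M = "token_measurement d U W x", OF _ _ finite_tokens[OF assms(1,2)]]
  note D = quantum_isomorphismD[OF Q]
  from x consider v where "x = V1 v" "v \<in> verts \<Lambda>1" | w where "x = V2 w" "w \<in> verts \<Lambda>2"
    | e where "x = E1 e" "e \<in> hedges \<Lambda>1" | f where "x = E2 f" "f \<in> hedges \<Lambda>2"
    by (auto simp: tokens_def)
  then show ?thesis
  proof cases
    case (1 v)
    show ?thesis
      by (rule main[where Z = "verts \<Lambda>2" and c = V2]) (use 1 D(1) in \<open>auto simp: tokens_def inj_def\<close>)
  next
    case (2 w)
    show ?thesis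
      by (rule main[where Z = "verts \<Lambda>1" and c = V1]) (use 2 D(2) in \<open>auto simp: tokens_def inj_def\<close>)
  next
    case (3 e)
    show ?thesis
      by (rule main[where Z = "hedges \<Lambda>2" and c = E2]) (use 3 D(3) in \<open>auto simp: tokens_def inj_def\<close>)
  next
    case (4 f)
    show ?thesis
      by (rule main[where Z = "hedges \<Lambda>1" and c = E1]) (use 4 D(4) in \<open>auto simp: tokens_def inj_def\<close>)
  qed
qed

lemma pvm_carrier: "pvm d A M \<Longrightarrow> a \<in> A \<Longrightarrow> M a \<in> carrier_mat d d"
  by (rule projection_carrier[OF pvm_projection])

lemma token_measurement_type_rule:
  assumes "x \<in> tokens \<Lambda>1 \<Lambda>2" "a \<in> tokens \<Lambda>1 \<Lambda>2" "\<not> type_rule \<Lambda>1 \<Lambda>2 x a"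
  shows "token_measurement d U W x a = 0\<^sub>m d d"
  using assms by (cases x; cases a) (auto simp: type_rule_def tokens_def)

lemma token_measurement_orthogonal:
  assumes Q: "quantum_isomorphism d \<Lambda>1 \<Lambda>2 U W"
    and t: "x \<in> tokens \<Lambda>1 \<Lambda>2" "a \<in> tokens \<Lambda>1 \<Lambda>2" "y \<in> tokens \<Lambda>1 \<Lambda>2" "b \<in> tokens \<Lambda>1 \<Lambda>2"
    and rule: "\<not> (incidence_rule \<Lambda>1 \<Lambda>2 x y a b \<and> vertex_rule \<Lambda>1 \<Lambda>2 x y a b \<and> edge_rule \<Lambda>1 \<Lambda>2 x y a b)"
  shows "token_measurement d U W x a * token_measurement d U W y b = 0\<^sub>m d d"
proof -
  note D = quantum_isomorphismD[OF Q]
  from rule consider "\<not> incidence_rule \<Lambda>1 \<Lambda>2 x y a b" | "\<not> vertex_rule \<Lambda>1 \<Lambda>2 x y a b"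
    | "\<not> edge_rule \<Lambda>1 \<Lambda>2 x y a b" by blast
  then show ?thesis
  proof cases
    case 1
    then obtain v e w f where
      "x = V1 v \<and> y = E1 e \<and> a = V2 w \<and> b = E2 f \<or> x = V2 w \<and> y = E2 f \<and> a = V1 v \<and> b = E1 e"
      and ne: "(v \<in> inc \<Lambda>1 e) \<noteq> (w \<in> inc \<Lambda>2 f)"
      unfolding incidence_rule_def by blast
    with t D(5)[of v w e f] show ?thesis by (auto simp: tokens_def)
  next
    case 2
    then obtain v w v' w' where eq: "{x, a} = {V1 v, V2 w}" "{y, b} = {V1 v', V2 w'}"
      and ne: "vertex_rel \<Lambda>1 v v' \<noteq> vertex_rel \<Lambda>2 w w'"
      unfolding vertex_rule_def by blast
    have mem: "v \<in> verts \<Lambda>1" "w \<in> verts \<Lambda>2" "v' \<in> verts \<Lambda>1" "w' \<in> verts \<Lambda>2"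
      using eq t by (auto simp: tokens_def doubleton_eq_iff)
    have "token_measurement d U W x a = U v w" "token_measurement d U W y b = U v' w'"
      using eq by (auto simp: doubleton_eq_iff)
    with D(6)[OF mem ne] show ?thesis by simp
  next
    case 3
    then obtain e f e' f' where eq: "{x, a} = {E1 e, E2 f}" "{y, b} = {E1 e', E2 f'}"
      and ne: "edge_rel \<Lambda>1 e e' \<noteq> edge_rel \<Lambda>2 f f'"
      unfolding edge_rule_def by blast
    have mem: "e \<in> hedges \<Lambda>1" "f \<in> hedges \<Lambda>2" "e' \<in> hedges \<Lambda>1" "f' \<in> hedges \<Lambda>2"
      using eq t by (auto simp: tokens_def doubleton_eq_iff)
    have "token_measurement d U W x a = W e f" "token_measurement d U W y b = W e' f'"
      using eq by (auto simp: doubleton_eq_iff)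
    with D(7)[OF mem ne] show ?thesis by simp
  qed
qed

text \<open>Answers of the wrong type have projection zero, and the other losing combinations are
  orthogonal by the definition of a quantum isomorphism.\<close>
theorem quantum_isomorphism_imp_q_isomorphic:
  assumes "d > 0" and hyp: "is_hypergraph \<Lambda>1" "is_hypergraph \<Lambda>2"
    and Q: "quantum_isomorphism d \<Lambda>1 \<Lambda>2 U W"
  shows "q_isomorphic \<Lambda>1 \<Lambda>2"
  unfolding q_isomorphic_def
proof (rule perfect_quantum_strategy_from_pvms[OF \<open>d > 0\<close>,
      where E = "token_measurement d U W" and F = "token_measurement d U W"])
  note pvm = pvm_token_measurement[OF hyp Q]
  fix x y a b
  assume "x \<in> questionsA (HypIso \<Lambda>1 \<Lambda>2)" "y \<in> questionsB (HypIso \<Lambda>1 \<Lambda>2)"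
    "a \<in> answersA (HypIso \<Lambda>1 \<Lambda>2)" "b \<in> answersB (HypIso \<Lambda>1 \<Lambda>2)"
    and rule: "\<not> rule_fun (HypIso \<Lambda>1 \<Lambda>2) x y a b"
  then have t: "x \<in> tokens \<Lambda>1 \<Lambda>2" "a \<in> tokens \<Lambda>1 \<Lambda>2" "y \<in> tokens \<Lambda>1 \<Lambda>2" "b \<in> tokens \<Lambda>1 \<Lambda>2"
    by (auto simp: HypIso_def)
  let ?M = "token_measurement d U W"
  have dim: "dim_col (?M x a) = d" "dim_row (?M y b) = d"
    "dim_row (?M x a) = d" "dim_col (?M y b) = d"
    using pvm_carrier[OF pvm[OF t(1)] t(2)] pvm_carrier[OF pvm[OF t(3)] t(4)] by auto
  show "?M x a * ?M y b = 0\<^sub>m d d"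
  proof (cases "type_rule \<Lambda>1 \<Lambda>2 x a \<and> type_rule \<Lambda>1 \<Lambda>2 y b")
    case True
    with rule show ?thesis
      by (intro token_measurement_orthogonal[OF Q t]) (auto simp: HypIso_def)
  next
    case False
    then have "?M x a = 0\<^sub>m d d \<or> ?M y b = 0\<^sub>m d d"
      using token_measurement_type_rule t by blast
    then show ?thesis using dim by (metis left_mult_zero_mat' right_mult_zero_mat')
  qed
qed (use pvm_token_measurement[OF hyp Q] in \<open>auto simp: HypIso_def\<close>)

section \<open>Classical isomorphisms\<close>

definition isomorphism ::
    "('v, 'e) hypergraph \<Rightarrow> ('w, 'f) hypergraph \<Rightarrow> ('v \<Rightarrow> 'w) \<Rightarrow> ('e \<Rightarrow> 'f) \<Rightarrow> bool" where
  "isomorphism \<Lambda>1 \<Lambda>2 g h \<longleftrightarrow>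
     bij_betw g (verts \<Lambda>1) (verts \<Lambda>2) \<and> bij_betw h (hedges \<Lambda>1) (hedges \<Lambda>2) \<and>
     (\<forall>v\<in>verts \<Lambda>1. \<forall>e\<in>hedges \<Lambda>1. v \<in> inc \<Lambda>1 e \<longleftrightarrow> g v \<in> inc \<Lambda>2 (h e))"

lemma prob_dist_has_positive: "prob_dist C q \<Longrightarrow> \<exists>c\<in>C. q c > 0"
  unfolding prob_dist_def by (metis less_eq_real_def sum_nonpos zero_less_one less_numeral_extra(1) not_less)

text \<open>In a local strategy pick a term of the convex combination with positive weight, and for
  every question an answer that has positive probability in this term.  Every combination of these
  answers occurs with positive probability, so it must win.\<close>
lemma perfect_local_strategy_imp_deterministic:
  assumes "has_perfect_local_strategy G"
  obtains \<alpha> \<beta> where "\<And>x. x \<in> questionsA G \<Longrightarrow> \<alpha> x \<in> answersA G"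
    "\<And>y. y \<in> questionsB G \<Longrightarrow> \<beta> y \<in> answersB G"
    "\<And>x y. x \<in> questionsA G \<Longrightarrow> y \<in> questionsB G \<Longrightarrow> rule_fun G x y (\<alpha> x) (\<beta> y)"
proof -
  from assms obtain p where perf: "perfect G p"
    and p_loc: "p \<in> local_correlations (questionsA G) (questionsB G) (answersA G) (answersB G)"
    unfolding has_perfect_local_strategy_def by (elim bexE)
  from conjunct2[OF CollectD[OF p_loc[unfolded local_correlations_def]]]
  obtain k c q r where kcqr: "prob_dist {..<k::nat} c \<and>
      (\<forall>i<k. \<forall>x\<in>questionsA G. prob_dist (answersA G) (q i x)) \<and>
      (\<forall>i<k. \<forall>y\<in>questionsB G. prob_dist (answersB G) (r i y)) \<and>
      (\<forall>x\<in>questionsA G. \<forall>y\<in>questionsB G. \<forall>a\<in>answersA G. \<forall>b\<in>answersB G.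
         p x y a b = (\<Sum>i<k. c i * q i x a * r i y b))"
    by (elim exE) (rule that)
  then have c: "prob_dist {..<k} c"
    and q: "\<And>i x. i < k \<Longrightarrow> x \<in> questionsA G \<Longrightarrow> prob_dist (answersA G) (q i x)"
    and r: "\<And>i y. i < k \<Longrightarrow> y \<in> questionsB G \<Longrightarrow> prob_dist (answersB G) (r i y)"
    and p: "\<And>x y a b. \<lbrakk>x \<in> questionsA G; y \<in> questionsB G; a \<in> answersA G; b \<in> answersB G\<rbrakk>
      \<Longrightarrow> p x y a b = (\<Sum>i<k. c i * q i x a * r i y b)"
    by simp_all
  obtain i where i: "i < k" "c i > 0" using prob_dist_has_positive[OF c] by auto
  obtain \<alpha> where \<alpha>: "\<And>x. x \<in> questionsA G \<Longrightarrow> \<alpha> x \<in> answersA G \<and> q i x (\<alpha> x) > 0"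
    using prob_dist_has_positive[OF q[OF i(1)]] by metis
  obtain \<beta> where \<beta>: "\<And>y. y \<in> questionsB G \<Longrightarrow> \<beta> y \<in> answersB G \<and> r i y (\<beta> y) > 0"
    using prob_dist_has_positive[OF r[OF i(1)]] by metis
  have "rule_fun G x y (\<alpha> x) (\<beta> y)" if x: "x \<in> questionsA G" and y: "y \<in> questionsB G" for x y
  proof -
    have nonneg: "0 \<le> c j * q j x (\<alpha> x) * r j y (\<beta> y)" if "j \<in> {..<k}" for j
      using that c q[of j, OF _ x] r[of j, OF _ y] \<alpha>[OF x] \<beta>[OF y] by (simp add: prob_dist_def)
    have "0 < c i * q i x (\<alpha> x) * r i y (\<beta> y)" using i \<alpha>[OF x] \<beta>[OF y] by simp
    also have "\<dots> \<le> (\<Sum>j<k. c j * q j x (\<alpha> x) * r j y (\<beta> y))"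
      using i nonneg by (intro member_le_sum) auto
    also have "\<dots> = p x y (\<alpha> x) (\<beta> y)" using p[OF x y] \<alpha>[OF x] \<beta>[OF y] by simp
    finally show ?thesis
      using perf x y \<alpha>[OF x] \<beta>[OF y] unfolding perfect_def by force
  qed
  then show ?thesis using that[of \<alpha> \<beta>] \<alpha> \<beta> by blast
qed

lemma mutually_matched_maps_bij:
  assumes g: "\<And>v. v \<in> A \<Longrightarrow> g v \<in> B" and g': "\<And>w. w \<in> B \<Longrightarrow> g' w \<in> A"
    and eq: "\<And>v w. v \<in> A \<Longrightarrow> w \<in> B \<Longrightarrow> v = g' w \<longleftrightarrow> g v = w"
  shows "bij_betw g A B"
proof (rule bij_betwI[where g = g'])
  show "g' (g v) = v" if "v \<in> A" for v using eq[OF that g[OF that]] by simp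
  show "g (g' w) = w" if "w \<in> B" for w using eq[OF g'[OF that] that] by simp
qed (use g g' in auto)

text \<open>Take the deterministic answers of both players.  Alice's answer to a vertex \<open>v\<close> of \<open>\<Lambda>1\<close>
  and Bob's answer to a vertex \<open>w\<close> of \<open>\<Lambda>2\<close> are linked by the equality part of the vertex
  rule: one is \<open>w\<close> exactly when the other is \<open>v\<close>, so the two answer maps are mutually inverse.
  The same holds for hyperedges.  The incidence rule only constrains Alice's vertices against Bob's
  hyperedges, which is why the vertex map is taken from Alice and the hyperedge map from Bob.\<close>
theorem loc_isomorphic_imp_isomorphism:
  fixes \<Lambda>1 :: "('v, 'e) hypergraph" and \<Lambda>2 :: "('w, 'f) hypergraph"
  assumes "loc_isomorphic \<Lambda>1 \<Lambda>2"
  obtains g h where "isomorphism \<Lambda>1 \<Lambda>2 g h"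
proof -
  define T where "T = tokens \<Lambda>1 \<Lambda>2"
  define R where "R = rule_fun (HypIso \<Lambda>1 \<Lambda>2)"
  from assms obtain \<alpha> \<beta> where R: "\<And>x y. x \<in> T \<Longrightarrow> y \<in> T \<Longrightarrow> R x y (\<alpha> x) (\<beta> y)"
    unfolding loc_isomorphic_def R_def T_def
    by (rule perfect_local_strategy_imp_deterministic) (auto simp: HypIso_def)
  have type: "type_rule \<Lambda>1 \<Lambda>2 x (\<alpha> x)" "type_rule \<Lambda>1 \<Lambda>2 x (\<beta> x)" if "x \<in> T" for x
    using R[OF that that] by (auto simp: R_def HypIso_def)
  have vr: "vertex_rule \<Lambda>1 \<Lambda>2 x y (\<alpha> x) (\<beta> y)" and er: "edge_rule \<Lambda>1 \<Lambda>2 x y (\<alpha> x) (\<beta> y)"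
    and ir: "incidence_rule \<Lambda>1 \<Lambda>2 x y (\<alpha> x) (\<beta> y)" if "x \<in> T" "y \<in> T" for x y
    using R[OF that] by (auto simp: R_def HypIso_def)
  have T: "v \<in> verts \<Lambda>1 \<Longrightarrow> V1 v \<in> T" "w \<in> verts \<Lambda>2 \<Longrightarrow> V2 w \<in> T"
    "e \<in> hedges \<Lambda>1 \<Longrightarrow> E1 e \<in> T" "f \<in> hedges \<Lambda>2 \<Longrightarrow> E2 f \<in> T" for v w e f
    by (auto simp: T_def tokens_def)
  have "\<forall>v\<in>verts \<Lambda>1. \<exists>w. w \<in> verts \<Lambda>2 \<and> \<alpha> (V1 v) = V2 w"
    using type(1) T(1) by (fastforce simp: type_rule_def)
  then obtain g where g: "\<And>v. v \<in> verts \<Lambda>1 \<Longrightarrow> g v \<in> verts \<Lambda>2 \<and> \<alpha> (V1 v) = V2 (g v)" by metis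
  have "\<forall>w\<in>verts \<Lambda>2. \<exists>v. v \<in> verts \<Lambda>1 \<and> \<beta> (V2 w) = V1 v"
    using type(2) T(2) by (fastforce simp: type_rule_def)
  then obtain g' where g': "\<And>w. w \<in> verts \<Lambda>2 \<Longrightarrow> g' w \<in> verts \<Lambda>1 \<and> \<beta> (V2 w) = V1 (g' w)" by metis
  have "\<forall>f\<in>hedges \<Lambda>2. \<exists>e. e \<in> hedges \<Lambda>1 \<and> \<alpha> (E2 f) = E1 e"
    using type(1) T(4) by (fastforce simp: type_rule_def)
  then obtain h' where h': "\<And>f. f \<in> hedges \<Lambda>2 \<Longrightarrow> h' f \<in> hedges \<Lambda>1 \<and> \<alpha> (E2 f) = E1 (h' f)" by metis
  have "\<forall>e\<in>hedges \<Lambda>1. \<exists>f. f \<in> hedges \<Lambda>2 \<and> \<beta> (E1 e) = E2 f"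
    using type(2) T(3) by (fastforce simp: type_rule_def)
  then obtain h where h: "\<And>e. e \<in> hedges \<Lambda>1 \<Longrightarrow> h e \<in> hedges \<Lambda>2 \<and> \<beta> (E1 e) = E2 (h e)" by metis
  have gg': "v = g' w \<longleftrightarrow> g v = w" if vw: "v \<in> verts \<Lambda>1" "w \<in> verts \<Lambda>2" for v w
  proof -
    have "vertex_rel \<Lambda>1 v (g' w) = vertex_rel \<Lambda>2 (g v) w"
      using vr[OF T(1)[OF vw(1)] T(2)[OF vw(2)]] g[OF vw(1)] g'[OF vw(2)]
      by (simp add: vertex_rule_def doubleton_eq_iff)
    then show ?thesis by (auto simp: vertex_rel_def split: if_splits)
  qed
  have hh': "e = h' f \<longleftrightarrow> h e = f" if ef: "e \<in> hedges \<Lambda>1" "f \<in> hedges \<Lambda>2" for e f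
  proof -
    have "edge_rel \<Lambda>1 (h' f) e = edge_rel \<Lambda>2 f (h e)"
      using er[OF T(4)[OF ef(2)] T(3)[OF ef(1)]] h[OF ef(1)] h'[OF ef(2)]
      by (simp add: edge_rule_def doubleton_eq_iff)
    then show ?thesis by (auto simp: edge_rel_def split: if_splits)
  qed
  have "bij_betw g (verts \<Lambda>1) (verts \<Lambda>2)"
    by (rule mutually_matched_maps_bij[where g' = g']) (simp_all only: g g' gg')
  moreover have "bij_betw h (hedges \<Lambda>1) (hedges \<Lambda>2)"
    by (rule mutually_matched_maps_bij[where g' = h']) (simp_all only: h h' hh')
  moreover have "v \<in> inc \<Lambda>1 e \<longleftrightarrow> g v \<in> inc \<Lambda>2 (h e)" if ve: "v \<in> verts \<Lambda>1" "e \<in> hedges \<Lambda>1" for v e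
    using ir[OF T(1)[OF ve(1)] T(3)[OF ve(2)]] g[OF ve(1)] h[OF ve(2)]
    unfolding incidence_rule_def by blast
  ultimately have "isomorphism \<Lambda>1 \<Lambda>2 g h" by (simp add: isomorphism_def)
  then show ?thesis by (rule that)
qed

lemma isomorphism_sym:
  assumes "isomorphism \<Lambda>1 \<Lambda>2 g h"
  shows "isomorphism \<Lambda>2 \<Lambda>1 (inv_into (verts \<Lambda>1) g) (inv_into (hedges \<Lambda>1) h)"
proof -
  let ?g = "inv_into (verts \<Lambda>1) g" and ?h = "inv_into (hedges \<Lambda>1) h"
  have g: "bij_betw g (verts \<Lambda>1) (verts \<Lambda>2)" and h: "bij_betw h (hedges \<Lambda>1) (hedges \<Lambda>2)"
    and inc: "\<And>v e. v \<in> verts \<Lambda>1 \<Longrightarrow> e \<in> hedges \<Lambda>1 \<Longrightarrow> v \<in> inc \<Lambda>1 e \<longleftrightarrow> g v \<in> inc \<Lambda>2 (h e)"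
    using assms by (auto simp: isomorphism_def)
  have "w \<in> inc \<Lambda>2 f \<longleftrightarrow> ?g w \<in> inc \<Lambda>1 (?h f)" if "w \<in> verts \<Lambda>2" "f \<in> hedges \<Lambda>2" for w f
    using inc[of "?g w" "?h f"] that bij_betw_apply[OF bij_betw_inv_into[OF g]]
      bij_betw_apply[OF bij_betw_inv_into[OF h]]
    by (simp add: bij_betw_inv_into_right[OF g] bij_betw_inv_into_right[OF h])
  then show ?thesis by (simp add: isomorphism_def bij_betw_inv_into g h)
qed

lemma isomorphism_trans:
  assumes "isomorphism \<Lambda>1 \<Lambda>2 g h" "isomorphism \<Lambda>2 \<Lambda>3 g' h'"
  shows "isomorphism \<Lambda>1 \<Lambda>3 (g' \<circ> g) (h' \<circ> h)"
proof -
  have g: "bij_betw g (verts \<Lambda>1) (verts \<Lambda>2)" "bij_betw g' (verts \<Lambda>2) (verts \<Lambda>3)"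
    and h: "bij_betw h (hedges \<Lambda>1) (hedges \<Lambda>2)" "bij_betw h' (hedges \<Lambda>2) (hedges \<Lambda>3)"
    using assms by (auto simp: isomorphism_def)
  show ?thesis
    using assms bij_betw_trans[OF g] bij_betw_trans[OF h]
    by (simp add: isomorphism_def bij_betw_apply[OF g(1)] bij_betw_apply[OF h(1)])
qed

lemma isomorphism_vertex_rel:
  assumes iso: "isomorphism \<Lambda>1 \<Lambda>2 g h" and v: "v \<in> verts \<Lambda>1" "w \<in> verts \<Lambda>1"
  shows "vertex_rel \<Lambda>2 (g v) (g w) = vertex_rel \<Lambda>1 v w"
proof -
  have h: "hedges \<Lambda>2 = h ` hedges \<Lambda>1" and g: "g v = g w \<longleftrightarrow> v = w"
    using iso v by (auto simp: isomorphism_def bij_betw_def inj_on_def)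
  have "(\<exists>e\<in>hedges \<Lambda>2. g v \<in> inc \<Lambda>2 e \<and> g w \<in> inc \<Lambda>2 e) \<longleftrightarrow>
      (\<exists>e\<in>hedges \<Lambda>1. v \<in> inc \<Lambda>1 e \<and> w \<in> inc \<Lambda>1 e)"
    using iso v by (simp add: h isomorphism_def)
  with g show ?thesis by (simp add: vertex_rel_def)
qed

lemma isomorphism_inc:
  assumes iso: "isomorphism \<Lambda>1 \<Lambda>2 g h" and hyp: "is_hypergraph \<Lambda>1" "is_hypergraph \<Lambda>2"
    and e: "e \<in> hedges \<Lambda>1"
  shows "inc \<Lambda>2 (h e) = g ` inc \<Lambda>1 e"
proof -
  have g: "verts \<Lambda>2 = g ` verts \<Lambda>1" and "h e \<in> hedges \<Lambda>2"
    using iso e by (auto simp: isomorphism_def bij_betw_def)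
  moreover have "inc \<Lambda>2 (h e) \<subseteq> verts \<Lambda>2" "inc \<Lambda>1 e \<subseteq> verts \<Lambda>1"
    using hyp e \<open>h e \<in> hedges \<Lambda>2\<close> by (auto simp: is_hypergraph_def)
  moreover have "\<forall>v\<in>verts \<Lambda>1. v \<in> inc \<Lambda>1 e \<longleftrightarrow> g v \<in> inc \<Lambda>2 (h e)"
    using iso e by (simp add: isomorphism_def)
  ultimately show ?thesis unfolding g by auto
qed

lemma isomorphism_edge_rel:
  assumes iso: "isomorphism \<Lambda>1 \<Lambda>2 g h" and hyp: "is_hypergraph \<Lambda>1" "is_hypergraph \<Lambda>2"
    and e: "e \<in> hedges \<Lambda>1" "f \<in> hedges \<Lambda>1"
  shows "edge_rel \<Lambda>2 (h e) (h f) = edge_rel \<Lambda>1 e f"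
proof -
  have "inc \<Lambda>1 e \<subseteq> verts \<Lambda>1" "inc \<Lambda>1 f \<subseteq> verts \<Lambda>1"
    using hyp e by (auto simp: is_hypergraph_def)
  moreover have "inj_on g (verts \<Lambda>1)"
    using iso by (auto simp: isomorphism_def bij_betw_def)
  ultimately have "g ` inc \<Lambda>1 e \<inter> g ` inc \<Lambda>1 f = g ` (inc \<Lambda>1 e \<inter> inc \<Lambda>1 f)"
    by (simp add: inj_on_image_Int)
  moreover have "h e = h f \<longleftrightarrow> e = f"
    using iso e by (auto simp: isomorphism_def bij_betw_def inj_on_def)
  ultimately show ?thesis
    by (simp add: edge_rel_def isomorphism_inc[OF iso hyp] e)
qed

text \<open>Only incidence, equality and adjacency enter the definition, so quantum isomorphisms may be
  relabelled along classical ones.\<close>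
lemma quantum_isomorphism_transfer:
  assumes Q: "quantum_isomorphism d \<Lambda>1 \<Lambda>2 U W"
    and iso1: "isomorphism \<Lambda>1' \<Lambda>1 g1 h1" and iso2: "isomorphism \<Lambda>2' \<Lambda>2 g2 h2"
    and hyp: "is_hypergraph \<Lambda>1" "is_hypergraph \<Lambda>2" "is_hypergraph \<Lambda>1'" "is_hypergraph \<Lambda>2'"
  shows "quantum_isomorphism d \<Lambda>1' \<Lambda>2' (\<lambda>v w. U (g1 v) (g2 w)) (\<lambda>e f. W (h1 e) (h2 f))"
proof -
  note D = quantum_isomorphismD[OF Q]
  have b1: "bij_betw g1 (verts \<Lambda>1') (verts \<Lambda>1)" "bij_betw h1 (hedges \<Lambda>1') (hedges \<Lambda>1)"
    and b2: "bij_betw g2 (verts \<Lambda>2') (verts \<Lambda>2)" "bij_betw h2 (hedges \<Lambda>2') (hedges \<Lambda>2)"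
    using iso1 iso2 by (auto simp: isomorphism_def)
  note mem = b1[THEN bij_betw_apply] b2[THEN bij_betw_apply]
  have inc1: "v \<in> inc \<Lambda>1' e \<longleftrightarrow> g1 v \<in> inc \<Lambda>1 (h1 e)" if "v \<in> verts \<Lambda>1'" "e \<in> hedges \<Lambda>1'" for v e
    using iso1 that by (simp add: isomorphism_def)
  have inc2: "v \<in> inc \<Lambda>2' e \<longleftrightarrow> g2 v \<in> inc \<Lambda>2 (h2 e)" if "v \<in> verts \<Lambda>2'" "e \<in> hedges \<Lambda>2'" for v e
    using iso2 that by (simp add: isomorphism_def)
  show ?thesis
    unfolding quantum_isomorphism_def
    by (intro conjI ballI impI pvm_reindex[OF b1(1) D(2)] pvm_reindex[OF b1(2) D(4)]
        pvm_reindex[OF b2(1) D(1)] pvm_reindex[OF b2(2) D(3)] D(5-7) mem)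
      (simp_all add: inc1 inc2 isomorphism_vertex_rel[OF iso1] isomorphism_vertex_rel[OF iso2]
        isomorphism_edge_rel[OF iso1 hyp(3,1)] isomorphism_edge_rel[OF iso2 hyp(4,2)])
qed

text \<open>Together with the transfer of quantum isomorphisms, this allows the construction below to use
  whatever vertex and hyperedge types are convenient.\<close>
lemma isomorphic_nat_hypergraph:
  fixes \<Lambda> :: "('v, 'e) hypergraph"
  assumes hyp: "is_hypergraph \<Lambda>" and full: "full \<Lambda>"
  obtains \<Lambda>' :: "(nat, nat) hypergraph" and g h
  where "is_hypergraph \<Lambda>'" "full \<Lambda>'" "isomorphism \<Lambda>' \<Lambda> g h"
proof -
  obtain \<phi> :: "'v \<Rightarrow> nat" where \<phi>: "inj_on \<phi> (verts \<Lambda>)"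
    using finite_imp_inj_to_nat_seg hyp by (metis is_hypergraph_def)
  obtain \<psi> :: "'e \<Rightarrow> nat" where \<psi>: "inj_on \<psi> (hedges \<Lambda>)"
    using finite_imp_inj_to_nat_seg hyp by (metis is_hypergraph_def)
  define \<Lambda>' where "\<Lambda>' = \<lparr>verts = \<phi> ` verts \<Lambda>, hedges = \<psi> ` hedges \<Lambda>,
      inc = (\<lambda>e. \<phi> ` inc \<Lambda> (inv_into (hedges \<Lambda>) \<psi> e))\<rparr>"
  have sub: "\<forall>e\<in>hedges \<Lambda>. inc \<Lambda> e \<subseteq> verts \<Lambda>" using hyp by (simp add: is_hypergraph_def)
  have "is_hypergraph \<Lambda>'"
    using hyp sub \<psi> by (auto simp: is_hypergraph_def \<Lambda>'_def)
  moreover have "full \<Lambda>'"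
    unfolding full_def
  proof
    fix x assume "x \<in> verts \<Lambda>'"
    then obtain v where v: "v \<in> verts \<Lambda>" "x = \<phi> v" by (auto simp: \<Lambda>'_def)
    then obtain e where "e \<in> hedges \<Lambda>" "v \<in> inc \<Lambda> e" using full by (auto simp: full_def)
    then show "\<exists>e\<in>hedges \<Lambda>'. x \<in> inc \<Lambda>' e"
      using v \<psi> by (intro bexI[of _ "\<psi> e"]) (auto simp: \<Lambda>'_def)
  qed
  moreover have "isomorphism \<Lambda> \<Lambda>' \<phi> \<psi>"
    using \<phi> \<psi> sub by (auto simp: isomorphism_def \<Lambda>'_def bij_betw_def dest: inj_onD)
  ultimately show ?thesis using isomorphism_sym that by blast
qed

section \<open>The hypergraph of a system of linear equations\<close>

text \<open>An equation \<open>l\<close> over the two-element field asks that the values of the variables in \<open>sc l\<close>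
  sum to \<open>b l\<close>.  An assignment of values to these variables is represented by the set of
  variables that have value 1, so that addition of assignments is symmetric difference.\<close>
definition equation_solutions :: "('l \<Rightarrow> 'i set) \<Rightarrow> ('l \<Rightarrow> bool) \<Rightarrow> 'l \<Rightarrow> 'i set set" where
  "equation_solutions sc b l = {S. S \<subseteq> sc l \<and> (odd (card S) \<longleftrightarrow> b l)}"

text \<open>The vertices are the pairs of a variable and a value.  The hyperedge \<open>Inl i\<close> joins the two
  values of a variable, and \<open>Inr (l, S)\<close> is the graph of the solution \<open>S\<close> of
  the equation \<open>l\<close>.\<close>
definition system_hypergraph ::
    "'i set \<Rightarrow> 'l set \<Rightarrow> ('l \<Rightarrow> 'i set) \<Rightarrow> ('l \<Rightarrow> bool) \<Rightarrow> ('i \<times> bool, 'i + 'l \<times> 'i set) hypergraph" where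
  "system_hypergraph I L sc b =
     \<lparr> verts = I \<times> UNIV,
       hedges = Inl ` I \<union> Inr ` (SIGMA l:L. equation_solutions sc b l),
       inc = (\<lambda>e. case e of Inl i \<Rightarrow> {i} \<times> UNIV | Inr (l, S) \<Rightarrow> (\<lambda>i. (i, i \<in> S)) ` sc l) \<rparr>"

abbreviation homogeneous :: "'l \<Rightarrow> bool" where
  "homogeneous \<equiv> \<lambda>_. False"

text \<open>The bound 3 serves two purposes: the hyperedges of an equation are distinguished by their size
  from those of the variables, and any values of two different variables of an equation extend to a
  solution of it, so that adjacency of vertices is the same for every right-hand side.\<close>
locale linear_system =
  fixes I :: "'i set" and L :: "'l set" and sc :: "'l \<Rightarrow> 'i set"
  assumes finite_vars: "finite I" and finite_eqs: "finite L" and vars_nonempty: "I \<noteq> {}"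
    and scope: "l \<in> L \<Longrightarrow> sc l \<subseteq> I" and scope_card: "l \<in> L \<Longrightarrow> 3 \<le> card (sc l)"
begin

abbreviation "hyp \<equiv> system_hypergraph I L sc"
abbreviation "sol \<equiv> equation_solutions sc"

lemma finite_scope: "l \<in> L \<Longrightarrow> finite (sc l)"
  using scope finite_vars finite_subset by blast

lemma system_hypergraph_simps:
  "verts (hyp b) = I \<times> UNIV"
  "Inl i \<in> hedges (hyp b) \<longleftrightarrow> i \<in> I"
  "Inr (l, S) \<in> hedges (hyp b) \<longleftrightarrow> l \<in> L \<and> S \<in> sol b l"
  "inc (hyp b) (Inl i) = {i} \<times> UNIV"
  "inc (hyp b) (Inr (l, S)) = (\<lambda>i. (i, i \<in> S)) ` sc l"
  by (auto simp: system_hypergraph_def)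

lemma hedge_cases:
  assumes "e \<in> hedges (hyp b)"
  obtains i where "e = Inl i" "i \<in> I" | l S where "e = Inr (l, S)" "l \<in> L" "S \<in> sol b l"
  using assms by (auto simp: system_hypergraph_def)

lemma finite_equation_solutions: "l \<in> L \<Longrightarrow> finite (sol b l)"
  using finite_scope[of l] by (auto simp: equation_solutions_def intro: finite_subset[of _ "Pow (sc l)"])

lemma is_hypergraph_system: "is_hypergraph (hyp b)"
  using finite_vars finite_eqs vars_nonempty finite_equation_solutions
  by (auto simp: is_hypergraph_def system_hypergraph_def dest: subsetD[OF scope])

lemma full_system: "full (hyp b)"
  unfolding full_def
proof
  fix v assume "v \<in> verts (hyp b)"
  then show "\<exists>e\<in>hedges (hyp b). v \<in> inc (hyp b) e"
    by (intro bexI[of _ "Inl (fst v)"]) (auto simp: system_hypergraph_simps)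
qed

text \<open>A third variable \<open>k\<close> of the equation is free to correct the parity.\<close>
lemma equation_solutions_extend:
  assumes l: "l \<in> L" and ij: "i \<in> sc l" "j \<in> sc l" "i \<noteq> j"
  obtains S where "S \<in> sol b l" "i \<in> S \<longleftrightarrow> c" "j \<in> S \<longleftrightarrow> c'"
proof -
  have "\<not> sc l \<subseteq> {i, j}"
    using scope_card[OF l] card_mono[of "{i, j}" "sc l"] ij by auto
  then obtain k where k: "k \<in> sc l" "k \<noteq> i" "k \<noteq> j" by auto
  define S where "S = {m. m = i \<and> c \<or> m = j \<and> c'}"
  have S: "S \<subseteq> sc l" "i \<in> S \<longleftrightarrow> c" "j \<in> S \<longleftrightarrow> c'" "k \<notin> S" "finite S"
    using ij k finite_subset[of S "{i, j}"] by (auto simp: S_def)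
  show ?thesis
  proof (cases "odd (card S) \<longleftrightarrow> b l")
    case True
    then show ?thesis using S by (intro that[of S]) (auto simp: equation_solutions_def)
  next
    case False
    then show ?thesis using S k by (intro that[of "insert k S"]) (auto simp: equation_solutions_def)
  qed
qed

text \<open>Neither the right-hand side \<open>b\<close> nor the values of two different variables matter,
  because any two such values occur together in a solution of each equation that has both variables.
  Two different values of one variable touch in the hyperedge of that variable.\<close>
lemma vertex_rel_system:
  assumes "i \<in> I" "j \<in> I"
  shows "vertex_rel (hyp b) (i, c) (j, c') =
    (if i = j then (if c = c' then Equal else Touching)
     else if \<exists>l\<in>L. i \<in> sc l \<and> j \<in> sc l then Touching else Separate)"
proof (cases "i = j")
  case True
  have "\<exists>e\<in>hedges (hyp b). (i, c) \<in> inc (hyp b) e \<and> (i, c') \<in> inc (hyp b) e"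
    using assms by (intro bexI[of _ "Inl i"]) (auto simp: system_hypergraph_simps)
  with True show ?thesis
    by (simp only: vertex_rel_def prod.inject simp_thms if_True)
next
  case False
  have "(\<exists>e\<in>hedges (hyp b). (i, c) \<in> inc (hyp b) e \<and> (j, c') \<in> inc (hyp b) e) \<longleftrightarrow>
      (\<exists>l\<in>L. i \<in> sc l \<and> j \<in> sc l)"
  proof
    assume "\<exists>e\<in>hedges (hyp b). (i, c) \<in> inc (hyp b) e \<and> (j, c') \<in> inc (hyp b) e"
    then obtain e where e: "e \<in> hedges (hyp b)" "(i, c) \<in> inc (hyp b) e" "(j, c') \<in> inc (hyp b) e"
      by blast
    from e(1) show "\<exists>l\<in>L. i \<in> sc l \<and> j \<in> sc l"
      by (cases rule: hedge_cases) (use e False in \<open>auto simp: system_hypergraph_simps\<close>)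
  next
    assume "\<exists>l\<in>L. i \<in> sc l \<and> j \<in> sc l"
    then obtain l where l: "l \<in> L" "i \<in> sc l" "j \<in> sc l" by blast
    obtain S where "S \<in> sol b l" "i \<in> S \<longleftrightarrow> c" "j \<in> S \<longleftrightarrow> c'"
      using equation_solutions_extend[OF l False] .
    with l show "\<exists>e\<in>hedges (hyp b). (i, c) \<in> inc (hyp b) e \<and> (j, c') \<in> inc (hyp b) e"
      by (intro bexI[of _ "Inr (l, S)"]) (auto simp: system_hypergraph_simps)
  qed
  with False show ?thesis by (simp add: vertex_rel_def)
qed

lemma edge_rel_system:
  "edge_rel (hyp b) (Inl i) (Inl j) = (if i = j then Equal else Separate)"
  "edge_rel (hyp b) (Inl i) (Inr (l, S)) = (if i \<in> sc l then Touching else Separate)"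
  "edge_rel (hyp b) (Inr (l, S)) (Inl i) = (if i \<in> sc l then Touching else Separate)"
  "edge_rel (hyp b) (Inr (l, S)) (Inr (k, T)) =
    (if l = k \<and> S = T then Equal
     else if \<exists>i\<in>sc l \<inter> sc k. i \<in> S \<longleftrightarrow> i \<in> T then Touching else Separate)"
  by (auto simp: edge_rel_def system_hypergraph_simps image_iff)

section \<open>Isomorphisms with the homogeneous system are classical solutions\<close>

lemma card_inc_equation:
  assumes "l \<in> L"
  shows "3 \<le> card (inc (hyp b) (Inr (l, S)))"
  using scope_card[OF assms] by (simp add: system_hypergraph_simps card_image inj_on_def)

lemma hedge_card_2:
  assumes "e \<in> hedges (hyp b)" "card (inc (hyp b) e) = 2"
  obtains i where "e = Inl i" "i \<in> I"
  using assms(1)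
proof (cases rule: hedge_cases)
  case (2 l S)
  then show ?thesis using card_inc_equation[of l b S] assms(2) by simp
qed (rule that)

lemma card_inc_variable: "card (inc (hyp b) (Inl i)) = 2"
  by (simp add: system_hypergraph_simps card_cartesian_product)

text \<open>In the homogeneous system, the vertices with value 0 contain exactly one value of each
  variable and a hyperedge of every equation.  An isomorphism maps hyperedges of size 2 to hyperedges of
  size 2, so the image \<open>Z\<close> of these vertices again contains exactly one value of each variable; it
  is the graph of an assignment \<open>t\<close>.  The images of the equation hyperedges lie in
  \<open>Z\<close>, so each of them is the restriction of \<open>t\<close> to an equation.  Different hyperedges
  then come from different equations, and by counting every equation is satisfied by \<open>t\<close>.\<close>
theorem isomorphism_imp_solution:
  assumes iso: "isomorphism (hyp homogeneous) (hyp b) g h"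
  obtains t where "\<And>l. l \<in> L \<Longrightarrow> odd (card (t \<inter> sc l)) \<longleftrightarrow> b l"
proof -
  let ?H = "hyp homogeneous"
  have g: "bij_betw g (verts ?H) (verts (hyp b))" and h: "bij_betw h (hedges ?H) (hedges (hyp b))"
    using iso by (auto simp: isomorphism_def)
  note inc_h = isomorphism_inc[OF iso is_hypergraph_system is_hypergraph_system]
  have inj: "inj_on g (verts ?H)" using g by (simp add: bij_betw_def)
  have card_h: "card (inc (hyp b) (h e)) = card (inc ?H e)" if e: "e \<in> hedges ?H" for e
  proof -
    have "inc ?H e \<subseteq> verts ?H" using is_hypergraph_system[of homogeneous] e by (auto simp: is_hypergraph_def)
    then show ?thesis using inc_h[OF e] inj by (simp add: card_image inj_on_subset)
  qed
  define Z where "Z = g ` (I \<times> {False})"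
  define t where "t = {j. (j, True) \<in> Z}"
  \<comment> \<open>The hyperedge of the variable \<open>j\<close> is the image of that of some variable \<open>i\<close>.\<close>
  have Z: "(j, False) \<in> Z \<longleftrightarrow> (j, True) \<notin> Z" if j: "j \<in> I" for j
  proof -
    have "Inl j \<in> h ` hedges ?H"
      using j by (simp add: bij_betw_imp_surj_on[OF h] system_hypergraph_simps)
    then obtain e where e: "e \<in> hedges ?H" "h e = Inl j" by auto
    have "card (inc ?H e) = 2" using card_h[OF e(1)] card_inc_variable[of b j] e(2) by simp
    then obtain i where i: "e = Inl i" "i \<in> I" using hedge_card_2[OF e(1)] by blast
    have pair: "{(j, False), (j, True)} = {g (i, False), g (i, True)}"
    proof -
      have "{j} \<times> UNIV = g ` ({i} \<times> UNIV)"
        using inc_h[OF e(1)] e(2) i(1) by (simp add: system_hypergraph_simps)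
      then show ?thesis by (simp add: UNIV_bool insert_commute)
    qed
    have ne: "g (i, False) \<noteq> g (i, True)"
      using inj_onD[OF inj, of "(i, False)" "(i, True)"] i by (auto simp: system_hypergraph_simps)
    have "g (i, False) \<in> Z" using i by (auto simp: Z_def)
    moreover have "g (i, True) \<notin> Z"
    proof
      assume "g (i, True) \<in> Z"
      then obtain i' where i': "i' \<in> I" "g (i, True) = g (i', False)" by (auto simp: Z_def)
      then show False
        using inj_onD[OF inj i'(2)] i by (simp add: system_hypergraph_simps)
    qed
    ultimately show ?thesis using pair ne by (auto simp: doubleton_eq_iff)
  qed
  have ex: "\<exists>l'. l' \<in> L \<and> h (Inr (l, {})) = Inr (l', t \<inter> sc l') \<and> t \<inter> sc l' \<in> sol b l'"
    if l: "l \<in> L" for l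
  proof -
    have e: "Inr (l, {}) \<in> hedges ?H"
      using l by (simp add: system_hypergraph_simps equation_solutions_def)
    have "h (Inr (l, {})) \<in> hedges (hyp b)" using bij_betw_apply[OF h e] .
    then show ?thesis
    proof (cases rule: hedge_cases)
      case (1 i)
      then show ?thesis
        using card_h[OF e] card_inc_variable[of b i] card_inc_equation[OF l, of homogeneous "{}"] by simp
    next
      case (2 l' S)
      have "(\<lambda>i. (i, i \<in> S)) ` sc l' = g ` inc ?H (Inr (l, {}))"
        using inc_h[OF e] 2 by (simp add: system_hypergraph_simps)
      also have "\<dots> \<subseteq> Z"
        using scope[OF l] by (auto simp: Z_def system_hypergraph_simps)
      finally have in_Z: "(i, i \<in> S) \<in> Z" if "i \<in> sc l'" for i using that by auto
      have "i \<in> S \<longleftrightarrow> i \<in> t" if "i \<in> sc l'" for i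
        using in_Z[OF that] Z[of i] scope[OF 2(2)] that by (cases "i \<in> S") (auto simp: t_def)
      moreover have "S \<subseteq> sc l'" using 2 by (simp add: equation_solutions_def)
      ultimately have "S = t \<inter> sc l'" by blast
      with 2 show ?thesis by blast
    qed
  qed
  then obtain \<sigma> where \<sigma>: "\<And>l. l \<in> L \<Longrightarrow> \<sigma> l \<in> L"
    "\<And>l. l \<in> L \<Longrightarrow> h (Inr (l, {})) = Inr (\<sigma> l, t \<inter> sc (\<sigma> l))"
    "\<And>l. l \<in> L \<Longrightarrow> t \<inter> sc (\<sigma> l) \<in> sol b (\<sigma> l)"
    by metis
  \<comment> \<open>The set \<open>t\<close> and the equation \<open>\<sigma> l\<close> determine the image of the hyperedge of \<open>l\<close>.\<close>
  have "inj_on \<sigma> L"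
  proof (rule inj_onI)
    fix l k assume lk: "l \<in> L" "k \<in> L" "\<sigma> l = \<sigma> k"
    then have "h (Inr (l, {})) = h (Inr (k, {}))" using \<sigma>(2) by simp
    moreover have "Inr (l, {}) \<in> hedges ?H" "Inr (k, {}) \<in> hedges ?H"
      using lk by (simp_all add: system_hypergraph_simps equation_solutions_def)
    ultimately show "l = k" using h by (auto simp: bij_betw_def dest: inj_onD)
  qed
  with \<sigma>(1) have surj: "\<sigma> ` L = L" by (intro endo_inj_surj finite_eqs) auto
  show ?thesis
  proof (rule that[of t])
    fix l assume "l \<in> L"
    then obtain k where "k \<in> L" "l = \<sigma> k" using surj by auto
    then show "odd (card (t \<inter> sc l)) \<longleftrightarrow> b l" using \<sigma>(3)[of k] by (simp add: equation_solutions_def)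
  qed
qed

section \<open>Quantum solutions of linear systems\<close>

text \<open>A measurement for the value of each variable and one for the solution of each equation, such
  that the two never contradict each other.\<close>
definition quantum_solution ::
    "nat \<Rightarrow> ('l \<Rightarrow> bool) \<Rightarrow> ('i \<Rightarrow> bool \<Rightarrow> complex mat) \<Rightarrow> ('l \<Rightarrow> 'i set \<Rightarrow> complex mat) \<Rightarrow> bool" where
  "quantum_solution d b P Q \<longleftrightarrow>
     (\<forall>i\<in>I. pvm d UNIV (P i)) \<and> (\<forall>l\<in>L. pvm d (sol b l) (Q l)) \<and>
     (\<forall>l\<in>L. \<forall>S\<in>sol b l. \<forall>i\<in>sc l. P i (i \<notin> S) * Q l S = 0\<^sub>m d d)"

lemma quantum_solutionD:
  assumes "quantum_solution d b P Q"
  shows "i \<in> I \<Longrightarrow> pvm d UNIV (P i)" and "l \<in> L \<Longrightarrow> pvm d (sol b l) (Q l)"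
    and "\<lbrakk>l \<in> L; S \<in> sol b l; i \<in> sc l; c \<longleftrightarrow> i \<notin> S\<rbrakk> \<Longrightarrow> P i c * Q l S = 0\<^sub>m d d"
  using assms unfolding quantum_solution_def by auto

lemma pvm_bool_orthogonal:
  fixes c c' :: bool
  assumes M: "pvm d UNIV M" and "c \<noteq> c'"
  shows "M c * M c' = 0\<^sub>m d d"
proof -
  note proj = pvm_projection[OF M UNIV_I]
  note c = projection_carrier[OF proj]
  have compl: "M c' = 1\<^sub>m d - M c"
  proof (rule eq_matI)
    fix i j assume ij: "i < dim_row (1\<^sub>m d - M c)" "j < dim_col (1\<^sub>m d - M c)"
    then have ij': "i < d" "j < d" using c[of c] by auto
    have "c' \<longleftrightarrow> \<not> c" using \<open>c \<noteq> c'\<close> by simp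
    then have U: "UNIV = {c, c'}" by (cases c) auto
    have "M c $$ (i, j) + M c' $$ (i, j) = (\<Sum>a\<in>UNIV. M a $$ (i, j))"
      unfolding U using \<open>c \<noteq> c'\<close> by simp
    then show "M c' $$ (i, j) = (1\<^sub>m d - M c) $$ (i, j)"
      using pvm_sum[OF M ij'] ij' c[of c] by (auto simp: algebra_simps)
  qed (use c[of c] c[of c'] in auto)
  have "M c * M c' = M c * 1\<^sub>m d - M c * M c"
    unfolding compl using c by (intro mult_minus_distrib_mat[of _ d d _ d]) auto
  also have "\<dots> = 0\<^sub>m d d" using c[of c] by (simp add: projection_idem[OF proj])
  finally show ?thesis .
qed

text \<open>Insert the measurement of the common variable \<open>i\<close>: each of its two outcomes contradicts one
  of the two solutions.\<close>
lemma quantum_solution_equations_orthogonal: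
  assumes Q: "quantum_solution d b P Q" and lk: "l \<in> L" "k \<in> L" and ST: "S \<in> sol b l" "T \<in> sol b k"
    and i: "i \<in> sc l" "i \<in> sc k" "(i \<in> S) \<noteq> (i \<in> T)"
  shows "Q l S * Q k T = 0\<^sub>m d d"
proof -
  note D = quantum_solutionD[OF Q]
  have "i \<in> I" using scope lk i by blast
  note P = D(1)[OF this]
  note proj = pvm_projection[OF P UNIV_I] pvm_projection[OF D(2)[OF lk(1)] ST(1)]
    pvm_projection[OF D(2)[OF lk(2)] ST(2)]
  note c = proj[THEN projection_carrier]
  show ?thesis
  proof (rule mult_eq_zero_via_pvm[OF P c(2,3)])
    fix s
    show "Q l S * P i s * Q k T = 0\<^sub>m d d"
    proof (cases "s \<longleftrightarrow> i \<notin> S")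
      case True
      have "Q l S * P i s = 0\<^sub>m d d"
        by (rule projection_mult_eq_zero_commute[OF proj(1,2) D(3)[OF lk(1) ST(1) i(1) True]])
      then show ?thesis using c(3) by simp
    next
      case False
      then have "P i s * Q k T = 0\<^sub>m d d" using i(3) by (intro D(3)[OF lk(2) ST(2) i(2)]) auto
      moreover have "Q l S * P i s * Q k T = Q l S * (P i s * Q k T)"
        using c by (simp add: mat_assoc[where d = d])
      ultimately show ?thesis using c(2) by simp
    qed
  qed
qed

lemma even_card_sym_diff:
  assumes "finite S" "finite T"
  shows "even (card (sym_diff S T)) \<longleftrightarrow> (even (card S) \<longleftrightarrow> even (card T))"
proof -
  have "card S = card (S - T) + card (S \<inter> T)" "card T = card (T - S) + card (S \<inter> T)"
    using assms by (simp_all add: card_Diff_subset_Int Int_commute card_mono)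
  moreover have "card (sym_diff S T) = card (S - T) + card (T - S)"
    using assms by (intro card_Un_disjoint) auto
  ultimately show ?thesis by presburger
qed

text \<open>The parity of a sum of two assignments is the sum of the parities, and adding \<open>S\<close> is an
  involution.\<close>
lemma sym_diff_bij_equation_solutions:
  assumes l: "l \<in> L" and S: "S \<in> sol b l"
  shows "bij_betw (sym_diff S) (sol b' l) (sol (\<lambda>l. b l \<noteq> b' l) l)"
proof (rule bij_betwI[where g = "sym_diff S"])
  have fin: "finite T" if "T \<subseteq> sc l" for T using that finite_scope[OF l] finite_subset by blast
  show "sym_diff S \<in> sol b' l \<rightarrow> sol (\<lambda>l. b l \<noteq> b' l) l"
    using S fin by (auto simp: equation_solutions_def even_card_sym_diff)
  show "sym_diff S \<in> sol (\<lambda>l. b l \<noteq> b' l) l \<rightarrow> sol b' l"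
    using S fin by (auto simp: equation_solutions_def even_card_sym_diff)
qed auto

text \<open>The players add the measured value to the value in the question.  Addition is its own inverse,
  so the same formula answers the questions about either hypergraph.  The hyperedge of a variable
  contains both of its values and is therefore answered by the hyperedge of the same variable.\<close>
fun vertex_answer :: "nat \<Rightarrow> ('i \<Rightarrow> bool \<Rightarrow> complex mat) \<Rightarrow> 'i \<times> bool \<Rightarrow> 'i \<times> bool \<Rightarrow> complex mat" where
  "vertex_answer d P (i, c) (j, c') = (if i = j then P i (c \<noteq> c') else 0\<^sub>m d d)"

fun edge_answer ::
    "nat \<Rightarrow> ('l \<Rightarrow> 'i set \<Rightarrow> complex mat) \<Rightarrow> 'i + 'l \<times> 'i set \<Rightarrow> 'i + 'l \<times> 'i set \<Rightarrow> complex mat" where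
  "edge_answer d Q (Inl i) (Inl j) = (if i = j then 1\<^sub>m d else 0\<^sub>m d d)"
| "edge_answer d Q (Inr (l, S)) (Inr (k, T)) = (if l = k then Q l (sym_diff S T) else 0\<^sub>m d d)"
| "edge_answer d Q _ _ = 0\<^sub>m d d"

lemma vertex_answer_commute: "vertex_answer d P v w = vertex_answer d P w v"
  by (cases v; cases w) (auto intro: arg_cong[where f = "P _"])

lemma edge_answer_commute: "edge_answer d Q e f = edge_answer d Q f e"
  by (cases "(d, Q, e, f)" rule: edge_answer.cases) (auto simp: Un_commute)

lemma pvm_vertex_answer:
  assumes "\<And>i. i \<in> I \<Longrightarrow> pvm d UNIV (P i)" and v: "v \<in> I \<times> UNIV"
  shows "pvm d (I \<times> UNIV) (vertex_answer d P v)"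
proof -
  obtain i c where ic: "v = (i, c)" "i \<in> I" using v by auto
  have "bij_betw (\<lambda>v'. c \<noteq> snd v') ({i} \<times> UNIV) UNIV"
    by (rule bij_betwI[where g = "\<lambda>s. (i, c \<noteq> s)"]) auto
  from pvm_reindex[OF this assms(1)[OF ic(2)]]
  have "pvm d ({i} \<times> UNIV) (vertex_answer d P v)"
    by (rule pvm_cong[THEN iffD1, rotated]) (auto simp: ic)
  then show ?thesis
    by (rule pvm_extend_by_zero) (use ic finite_vars in auto)
qed

lemma pvm_edge_answer:
  assumes Q: "\<And>l. l \<in> L \<Longrightarrow> pvm d (sol (\<lambda>l. b l \<noteq> b' l) l) (Q l)" and e: "e \<in> hedges (hyp b)"
  shows "pvm d (hedges (hyp b')) (edge_answer d Q e)"
proof -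
  have fin: "finite (hedges (hyp b'))" using is_hypergraph_system by (simp add: is_hypergraph_def)
  from e show ?thesis
  proof (cases rule: hedge_cases)
    case (1 i)
    have "pvm d {Inl i} (edge_answer d Q e)" by (rule pvm_singleton) (simp add: 1)
    then show ?thesis
    proof (rule pvm_extend_by_zero[OF _ fin])
      show "edge_answer d Q e f = 0\<^sub>m d d" if "f \<in> hedges (hyp b') - {Inl i}" for f
        using that 1 by (cases f) auto
    qed (use 1 in \<open>auto simp: system_hypergraph_simps\<close>)
  next
    case (2 l S)
    from pvm_reindex[OF sym_diff_bij_equation_solutions[OF 2(2,3)] Q[OF 2(2)]]
    have "pvm d (sol b' l) (\<lambda>T. edge_answer d Q e (Inr (l, T)))"
      by (simp add: 2)
    then have "pvm d ((\<lambda>T. Inr (l, T)) ` sol b' l) (edge_answer d Q e)"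
      by (intro pvm_on_image[where c = "\<lambda>T. Inr (l, T)"])
        (auto simp: inj_on_def finite_equation_solutions[OF 2(2)])
    then show ?thesis
    proof (rule pvm_extend_by_zero[OF _ fin])
      fix f assume f: "f \<in> hedges (hyp b') - (\<lambda>T. Inr (l, T)) ` sol b' l"
      then have "f \<in> hedges (hyp b')" by simp
      then show "edge_answer d Q e f = 0\<^sub>m d d"
        by (cases rule: hedge_cases) (use f 2 in auto)
    qed (use 2 in \<open>auto simp: system_hypergraph_simps\<close>)
  qed
qed

text \<open>Adding the same assignment to two assignments does not change where they agree.  Measured
  values that do not contradict each other act like such a common shift, so they preserve all
  relations; where a relation changes, the measured values contradict each other on some variable, and the
  projections are orthogonal.  Adding a solution of the system \<open>b\<close> turns solutions of the
  homogeneous system into solutions of the system \<open>b\<close>, and conversely.\<close>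
theorem quantum_solution_imp_quantum_isomorphism:
  assumes Q: "quantum_solution d b P Q"
  shows "quantum_isomorphism d (hyp homogeneous) (hyp b) (vertex_answer d P) (edge_answer d Q)"
proof -
  note D = quantum_solutionD[OF Q]
  let ?H = "hyp homogeneous" and ?U = "vertex_answer d P" and ?W = "edge_answer d Q"
  have shift: "sym_diff S T \<in> sol b l" if "l \<in> L" "S \<in> sol homogeneous l" "T \<in> sol b l" for l S T
    using bij_betw_apply[OF sym_diff_bij_equation_solutions[OF that(1,2), of b] that(3)] by simp
  have Pc: "P i c \<in> carrier_mat d d" if "i \<in> I" for i c
    using pvm_carrier[OF D(1)[OF that]] by simp
  have Wc: "?W e f \<in> carrier_mat d d" if "e \<in> hedges ?H" "f \<in> hedges (hyp b)" for e f
    using pvm_carrier[OF pvm_edge_answer[of d homogeneous b Q, OF _ that(1)] that(2)] D(2) by simp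
  have U_sym: "(\<lambda>v. ?U v w) = ?U w" for w
    by (rule ext) (rule vertex_answer_commute)
  have W_sym: "(\<lambda>e. ?W e f) = ?W f" for f
    by (rule ext) (rule edge_answer_commute)
  have incidence: "?U v w * ?W e f = 0\<^sub>m d d"
    if v: "v \<in> verts ?H" and w: "w \<in> verts (hyp b)" and e: "e \<in> hedges ?H" and f: "f \<in> hedges (hyp b)"
      and ne: "(v \<in> inc ?H e) \<noteq> (w \<in> inc (hyp b) f)" for v w e f
  proof -
    obtain i c j c' where vw: "v = (i, c)" "w = (j, c')" "i \<in> I" "j \<in> I"
      using v w by (auto simp: system_hypergraph_simps)
    have Uc: "?U v w \<in> carrier_mat d d" using Pc vw by auto
    show ?thesis
    proof (cases "i = j \<and> ?W e f \<noteq> 0\<^sub>m d d")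
      case False
      then have "?U v w = 0\<^sub>m d d \<or> ?W e f = 0\<^sub>m d d" by (auto simp: vw)
      then show ?thesis using Uc Wc[OF e f] by auto
    next
      case True
      show ?thesis
        using e
      proof (cases rule: hedge_cases)
        case (1 k)
        then have "f = Inl k" using True by (cases f) (auto split: if_splits)
        then show ?thesis using ne 1 vw True by (auto simp: system_hypergraph_simps)
      next
        case (2 l S)
        then obtain T where T: "f = Inr (l, T)" using True by (cases f) (auto split: if_splits)
        then have TS: "T \<in> sol b l" using f by (simp add: system_hypergraph_simps)
        have "i \<in> sc l" "(c \<noteq> c') \<longleftrightarrow> i \<notin> sym_diff S T"
          using ne vw 2 T True by (auto simp: system_hypergraph_simps image_iff)
        then show ?thesis
          using D(3)[OF 2(2) shift[OF 2(2,3) TS], of i "c \<noteq> c'"] vw 2 T True by simp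
      qed
    qed
  qed
  have vertex: "?U v w * ?U v' w' = 0\<^sub>m d d"
    if v: "v \<in> verts ?H" "w \<in> verts (hyp b)" "v' \<in> verts ?H" "w' \<in> verts (hyp b)"
      and ne: "vertex_rel ?H v v' \<noteq> vertex_rel (hyp b) w w'" for v w v' w'
  proof -
    obtain i c j c' where vw: "v = (i, c)" "w = (j, c')" "i \<in> I" "j \<in> I"
      using v(1,2) by (auto simp: system_hypergraph_simps)
    obtain i' s j' s' where vw': "v' = (i', s)" "w' = (j', s')" "i' \<in> I" "j' \<in> I"
      using v(3,4) by (auto simp: system_hypergraph_simps)
    show ?thesis
    proof (cases "i = j \<and> i' = j'")
      case False
      have "?U v w \<in> carrier_mat d d" "?U v' w' \<in> carrier_mat d d" using Pc vw vw' by auto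
      then show ?thesis using False vw vw' by auto
    next
      case True
      then have "i = i'" and differ: "(c \<noteq> c') \<noteq> (s \<noteq> s')"
        using ne vw vw' by (auto simp: vertex_rel_system split: if_splits)
      then have "?U v w = P i (c \<noteq> c')" "?U v' w' = P i (s \<noteq> s')"
        using True vw vw' by simp_all
      then show ?thesis
        using pvm_bool_orthogonal[OF D(1)[OF vw(3)] differ] by (simp only:)
    qed
  qed
  have edge: "?W e f * ?W e' f' = 0\<^sub>m d d"
    if e: "e \<in> hedges ?H" "f \<in> hedges (hyp b)" "e' \<in> hedges ?H" "f' \<in> hedges (hyp b)"
      and ne: "edge_rel ?H e e' \<noteq> edge_rel (hyp b) f f'" for e f e' f'
  proof (rule ccontr)
    assume nz: "?W e f * ?W e' f' \<noteq> 0\<^sub>m d d"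
    have "?W e f \<noteq> 0\<^sub>m d d" "?W e' f' \<noteq> 0\<^sub>m d d"
      using nz Wc[OF e(1,2)] Wc[OF e(3,4)] by auto
    then have same: "(\<exists>i. e = Inl i \<and> f = Inl i) \<or> (\<exists>l S T. e = Inr (l, S) \<and> f = Inr (l, T))"
      "(\<exists>i. e' = Inl i \<and> f' = Inl i) \<or> (\<exists>l S T. e' = Inr (l, S) \<and> f' = Inr (l, T))"
      by (cases "(d, Q, e, f)" rule: edge_answer.cases; auto split: if_splits;
          cases "(d, Q, e', f')" rule: edge_answer.cases; auto split: if_splits)+
    then obtain l S T k S' T' where
      ef: "e = Inr (l, S)" "f = Inr (l, T)" "e' = Inr (k, S')" "f' = Inr (k, T')"
      using ne by (auto simp: edge_rel_system)
    then have mem: "l \<in> L" "S \<in> sol homogeneous l" "T \<in> sol b l"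
      "k \<in> L" "S' \<in> sol homogeneous k" "T' \<in> sol b k"
      using e by (auto simp: system_hypergraph_simps)
    \<comment> \<open>Without a contradiction, both pairs of hyperedges would be related in the same way.\<close>
    have "\<exists>i\<in>sc l \<inter> sc k. (i \<in> sym_diff S T) \<noteq> (i \<in> sym_diff S' T')"
    proof (rule ccontr)
      assume "\<not> ?thesis"
      then have agree: "i \<in> sym_diff S T \<longleftrightarrow> i \<in> sym_diff S' T'" if "i \<in> sc l" "i \<in> sc k" for i
        using that by blast
      then have "(\<exists>i\<in>sc l \<inter> sc k. i \<in> S \<longleftrightarrow> i \<in> S') \<longleftrightarrow> (\<exists>i\<in>sc l \<inter> sc k. i \<in> T \<longleftrightarrow> i \<in> T')"
        by blast
      moreover have "S = S' \<longleftrightarrow> T = T'" if "l = k"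
      proof -
        have "S \<subseteq> sc l" "T \<subseteq> sc l" "S' \<subseteq> sc l" "T' \<subseteq> sc l"
          using mem that by (auto simp: equation_solutions_def)
        then show ?thesis using agree that by blast
      qed
      ultimately show False using ne ef by (auto simp: edge_rel_system split: if_splits)
    qed
    then obtain i where "i \<in> sc l" "i \<in> sc k" "(i \<in> sym_diff S T) \<noteq> (i \<in> sym_diff S' T')"
      by blast
    then have "Q l (sym_diff S T) * Q k (sym_diff S' T') = 0\<^sub>m d d"
      using quantum_solution_equations_orthogonal[OF Q mem(1,4) shift[OF mem(1-3)] shift[OF mem(4-6)]]
      by blast
    with nz ef show False by simp
  qed
  have "pvm d (verts (hyp b)) (?U v)" if "v \<in> verts ?H" for v
    using pvm_vertex_answer[of d P v] D(1) that by (simp add: system_hypergraph_simps)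
  moreover have "pvm d (verts ?H) (\<lambda>v. ?U v w)" if "w \<in> verts (hyp b)" for w
    unfolding U_sym using pvm_vertex_answer[of d P w] D(1) that by (simp add: system_hypergraph_simps)
  moreover have "pvm d (hedges (hyp b)) (?W e)" if "e \<in> hedges ?H" for e
    using pvm_edge_answer[of d homogeneous b Q e] D(2) that by simp
  moreover have "pvm d (hedges ?H) (\<lambda>e. ?W e f)" if "f \<in> hedges (hyp b)" for f
    unfolding W_sym using pvm_edge_answer[of d b homogeneous Q f] D(2) that by simp
  ultimately show ?thesis
    unfolding quantum_isomorphism_def using incidence vertex edge by blast
qed

end

section \<open>Commuting observables\<close>

definition observable :: "nat \<Rightarrow> complex mat \<Rightarrow> bool" where
  "observable d A \<longleftrightarrow> A \<in> carrier_mat d d \<and> A * A = 1\<^sub>m d \<and>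
     (\<forall>i<d. \<forall>j<d. A $$ (j, i) = cnj (A $$ (i, j)))"

abbreviation parity_sign :: "bool \<Rightarrow> complex" where
  "parity_sign c \<equiv> if c then -1 else 1"

text \<open>The projection on the eigenspace of \<open>A\<close> for the eigenvalue \<open>parity_sign c\<close>.  The eigenvalues
  1 and -1 stand for the values 0 and 1 of a variable, so products of observables correspond to
  sums of values.\<close>
definition spectral_projection :: "nat \<Rightarrow> complex mat \<Rightarrow> bool \<Rightarrow> complex mat" where
  "spectral_projection d A c = (1 / 2) \<cdot>\<^sub>m (1\<^sub>m d + parity_sign c \<cdot>\<^sub>m A)"

lemma observable_carrier: "observable d A \<Longrightarrow> A \<in> carrier_mat d d"
  by (simp add: observable_def)

lemma spectral_projection_carrier:
  "observable d A \<Longrightarrow> spectral_projection d A c \<in> carrier_mat d d"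
  by (simp add: observable_def spectral_projection_def)

lemma mult_spectral_projection:
  assumes A: "A \<in> carrier_mat d d" and B: "B \<in> carrier_mat d d"
  shows "B * spectral_projection d A c = (1 / 2) \<cdot>\<^sub>m (B + parity_sign c \<cdot>\<^sub>m (B * A))"
    and "spectral_projection d A c * B = (1 / 2) \<cdot>\<^sub>m (B + parity_sign c \<cdot>\<^sub>m (A * B))"
  unfolding spectral_projection_def using A B
  by (simp_all add: mult_smult_distrib[of _ d d _ d] mult_smult_assoc_mat[of _ d d _ d]
      mult_add_distrib_mat[of _ d d _ d] add_mult_distrib_mat[of _ d d _ _ d])

lemma observable_mult_spectral_projection:
  assumes A: "observable d A"
  shows "A * spectral_projection d A c = parity_sign c \<cdot>\<^sub>m spectral_projection d A c"
proof -
  have c: "A \<in> carrier_mat d d" and AA: "A * A = 1\<^sub>m d" using A by (auto simp: observable_def)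
  show ?thesis
    unfolding mult_spectral_projection(1)[OF c c] AA
    unfolding spectral_projection_def
    by (rule eq_matI) (use c in \<open>auto simp: algebra_simps\<close>)
qed

lemma spectral_projection_commute:
  assumes "A \<in> carrier_mat d d" "B \<in> carrier_mat d d" "A * B = B * A"
  shows "spectral_projection d A c * B = B * spectral_projection d A c"
  using mult_spectral_projection[OF assms(1,2)] assms(3) by simp

lemma pvm_spectral_projection:
  assumes A: "observable d A"
  shows "pvm d UNIV (spectral_projection d A)"
proof (rule pvmI)
  let ?P = "spectral_projection d A"
  have c: "A \<in> carrier_mat d d" and herm: "\<And>i j. i < d \<Longrightarrow> j < d \<Longrightarrow> cnj (A $$ (i, j)) = A $$ (j, i)"
    using A unfolding observable_def by metis+
  note Pc = spectral_projection_carrier[OF A]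
  show "projection d (?P s)" for s
  proof (rule projectionI[OF Pc])
    show "?P s * ?P s = ?P s"
      unfolding mult_spectral_projection(2)[OF c Pc] observable_mult_spectral_projection[OF A]
      by (rule eq_matI) (use Pc in auto)
    show "?P s $$ (j, i) = cnj (?P s $$ (i, j))" if "i < d" "j < d" for i j
      using c that by (auto simp: spectral_projection_def herm)
  qed
  show "(\<Sum>s\<in>UNIV. ?P s $$ (i, j)) = (if i = j then 1 else 0)" if "i < d" "j < d" for i j
    using c that by (auto simp: UNIV_bool spectral_projection_def field_simps)
qed

text \<open>On the range of the product of the two projections, \<open>A\<close> and \<open>B\<close> act as the scalars
  \<open>parity_sign s\<close> and \<open>parity_sign t\<close>.  Hence \<open>C\<close> acts as a scalar too, and the condition on \<open>c\<close>
  says that \<open>c\<close> is the value with the opposite sign.\<close>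
lemma spectral_projection_product:
  assumes A: "observable d A" and B: "observable d B" and C: "observable d C"
    and comm: "A * B = B * A" and prod: "A * B = parity_sign b \<cdot>\<^sub>m C" and c: "c \<longleftrightarrow> ((s \<noteq> t) \<longleftrightarrow> b)"
  shows "spectral_projection d C c * (spectral_projection d A s * spectral_projection d B t) = 0\<^sub>m d d"
proof -
  let ?P = "spectral_projection d A s" and ?Q = "spectral_projection d B t"
  note carr = observable_carrier[OF A] observable_carrier[OF B] observable_carrier[OF C]
    spectral_projection_carrier[OF A, of s] spectral_projection_carrier[OF B, of t]
  note assoc = mat_assoc[where d = d] mat_closed[where d = d]
  have C_eq: "C = parity_sign b \<cdot>\<^sub>m (A * B)"
    unfolding prod by (rule eq_matI) (use carr in auto)
  have "B * (?P * ?Q) = (B * ?P) * ?Q" using carr by (simp add: assoc)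
  also have "\<dots> = (?P * B) * ?Q"
    by (simp only: spectral_projection_commute[OF carr(1,2) comm])
  also have "\<dots> = ?P * (B * ?Q)" using carr by (simp add: assoc)
  also have "\<dots> = parity_sign t \<cdot>\<^sub>m (?P * ?Q)"
    unfolding observable_mult_spectral_projection[OF B] using carr
    by (simp add: mult_smult_distrib[of _ d d _ d])
  finally have BPQ: "B * (?P * ?Q) = parity_sign t \<cdot>\<^sub>m (?P * ?Q)" .
  have "A * (?P * ?Q) = (A * ?P) * ?Q" using carr by (simp add: assoc)
  also have "\<dots> = parity_sign s \<cdot>\<^sub>m (?P * ?Q)"
    unfolding observable_mult_spectral_projection[OF A] using carr
    by (simp add: mult_smult_assoc_mat[of _ d d _ d])
  finally have APQ: "A * (?P * ?Q) = parity_sign s \<cdot>\<^sub>m (?P * ?Q)" .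
  have "C * (?P * ?Q) = parity_sign b \<cdot>\<^sub>m (A * (B * (?P * ?Q)))"
    unfolding C_eq using carr by (simp add: mult_smult_assoc_mat[of _ d d _ d] assoc)
  also have "\<dots> = parity_sign b \<cdot>\<^sub>m (parity_sign t \<cdot>\<^sub>m (parity_sign s \<cdot>\<^sub>m (?P * ?Q)))"
    unfolding BPQ using carr by (simp add: mult_smult_distrib[of _ d d _ d] APQ)
  finally have "C * (?P * ?Q) = parity_sign b \<cdot>\<^sub>m (parity_sign t \<cdot>\<^sub>m (parity_sign s \<cdot>\<^sub>m (?P * ?Q)))" .
  then have "spectral_projection d C c * (?P * ?Q) =
      (1 / 2) \<cdot>\<^sub>m (?P * ?Q + parity_sign c \<cdot>\<^sub>m (parity_sign b \<cdot>\<^sub>m (parity_sign t \<cdot>\<^sub>m (parity_sign s \<cdot>\<^sub>m (?P * ?Q)))))"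
    using mult_spectral_projection(2)[OF carr(3) mult_carrier_mat[OF carr(4,5)]] by simp
  also have "\<dots> = 0\<^sub>m d d"
    by (rule eq_matI) (use carr c in \<open>auto simp del: index_mult_mat(1)\<close>)
  finally show ?thesis .
qed


section \<open>Quantum solutions from observables\<close>

lemma odd_card_triple:
  assumes "distinct [i, j, k]" and S: "S \<subseteq> {i, j, k}"
  shows "odd (card S) \<longleftrightarrow> (((i \<in> S) \<noteq> (j \<in> S)) \<noteq> (k \<in> S))"
proof -
  have "S \<in> Pow {i, j, k}" using S by simp
  then show ?thesis using assms(1) unfolding Pow_insert by auto
qed

text \<open>The values of two variables are free, and the parity determines that of the third.\<close>
lemma equation_solutions_triple_bij:
  assumes dist: "distinct [i, j, k]" and sc: "sc l = {i, j, k}"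
  shows "bij_betw (\<lambda>S. (i \<in> S, j \<in> S)) (equation_solutions sc b l) (UNIV \<times> UNIV)"
proof (rule bij_betwI)
  define R where "R = (\<lambda>(s, t). {m. m = i \<and> s \<or> m = j \<and> t \<or> m = k \<and> ((s \<noteq> t) \<noteq> b l)})"
  note parity = odd_card_triple[OF dist]
  show "R \<in> UNIV \<times> UNIV \<rightarrow> equation_solutions sc b l"
  proof
    fix st :: "bool \<times> bool"
    obtain s t where st: "st = (s, t)" by (cases st)
    have sub: "R st \<subseteq> {i, j, k}" by (auto simp: R_def st)
    have "i \<in> R st \<longleftrightarrow> s" "j \<in> R st \<longleftrightarrow> t" "k \<in> R st \<longleftrightarrow> (s \<noteq> t) \<noteq> b l"
      using dist by (auto simp: R_def st)
    then have "odd (card (R st)) \<longleftrightarrow> b l" unfolding parity[OF sub] by argo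
    with sub show "R st \<in> equation_solutions sc b l" by (simp add: equation_solutions_def sc)
  qed
  show "R (i \<in> S, j \<in> S) = S" if "S \<in> equation_solutions sc b l" for S
  proof -
    have sub: "S \<subseteq> {i, j, k}" and odd: "odd (card S) \<longleftrightarrow> b l"
      using that by (auto simp: equation_solutions_def sc)
    from odd have k: "k \<in> S \<longleftrightarrow> ((i \<in> S) \<noteq> (j \<in> S)) \<noteq> b l"
      unfolding parity[OF sub] by argo
    have "m \<in> R (i \<in> S, j \<in> S) \<longleftrightarrow> m = i \<and> i \<in> S \<or> m = j \<and> j \<in> S \<or> m = k \<and> k \<in> S" for m
      by (simp add: R_def k)
    then show ?thesis using sub by auto
  qed
  show "(i \<in> R st, j \<in> R st) = st" for st using dist by (cases st) (auto simp: R_def)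
qed auto

text \<open>The observables on a line commute, so the first two can be measured jointly; together they
  determine a solution of the equation.  That the outcome agrees with
  the third observable is the product relation \<open>A i * A j = parity_sign (b l) \<cdot>\<^sub>m A k\<close>.\<close>
lemma (in linear_system) quantum_solution_from_observables:
  assumes A: "\<And>i. i \<in> I \<Longrightarrow> observable d (A i)"
    and line: "\<And>l i j k. l \<in> L \<Longrightarrow> line l = (i, j, k) \<Longrightarrow>
      sc l = {i, j, k} \<and> distinct [i, j, k] \<and>
      A i * A j = parity_sign (b l) \<cdot>\<^sub>m A k \<and> A j * A i = parity_sign (b l) \<cdot>\<^sub>m A k"
  shows "quantum_solution d b (\<lambda>i. spectral_projection d (A i))
    (\<lambda>l S. case line l of (i, j, k) \<Rightarrow>
       spectral_projection d (A i) (i \<in> S) * spectral_projection d (A j) (j \<in> S))"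
    (is "quantum_solution d b ?P ?Q")
  unfolding quantum_solution_def
proof (intro conjI ballI)
  show "pvm d UNIV (?P i)" if "i \<in> I" for i by (rule pvm_spectral_projection[OF A[OF that]])
  fix l assume l: "l \<in> L"
  obtain i j k where ijk: "line l = (i, j, k)" by (cases "line l")
  note sc = line[OF l ijk, THEN conjunct1]
  note dist = line[OF l ijk, THEN conjunct2, THEN conjunct1]
  have prod: "A i * A j = parity_sign (b l) \<cdot>\<^sub>m A k" and comm: "A i * A j = A j * A i"
    using line[OF l ijk] by simp_all
  have mem: "i \<in> I" "j \<in> I" "k \<in> I" using scope[OF l] sc by auto
  note carr = A[OF mem(1), THEN observable_carrier] A[OF mem(2), THEN observable_carrier]
  have PP: "?P i s * ?P j t = ?P j t * ?P i s" for s t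
  proof -
    have "?P i s * A j = A j * ?P i s" by (rule spectral_projection_commute[OF carr comm])
    then show ?thesis
      using spectral_projection_commute[OF carr(2) spectral_projection_carrier[OF A[OF mem(1)]], of s t]
      by simp
  qed
  have "pvm d (UNIV \<times> UNIV) (\<lambda>(s, t). ?P i s * ?P j t)"
    by (intro pvm_product pvm_spectral_projection A mem PP)
  from pvm_reindex[OF equation_solutions_triple_bij[where sc = sc and l = l and b = b, OF dist sc] this]
  show "pvm d (sol b l) (?Q l)" by (simp add: ijk)
  fix S m assume S: "S \<in> sol b l" and m: "m \<in> sc l"
  have sub: "S \<subseteq> {i, j, k}" and odd: "odd (card S) \<longleftrightarrow> b l"
    using S by (auto simp: equation_solutions_def sc)
  have Pc: "?P n s \<in> carrier_mat d d" if "n \<in> I" for n s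
    by (rule spectral_projection_carrier[OF A[OF that]])
  have orth: "?P n (n \<notin> S) * ?P n (n \<in> S) = 0\<^sub>m d d" if "n \<in> I" for n
    by (rule pvm_bool_orthogonal[OF pvm_spectral_projection[OF A[OF that]]]) simp
  from m sc consider "m = i" | "m = j" | "m = k" by auto
  then show "?P m (m \<notin> S) * ?Q l S = 0\<^sub>m d d"
  proof cases
    case 1
    have "?P i (i \<notin> S) * (?P i (i \<in> S) * ?P j (j \<in> S)) =
        (?P i (i \<notin> S) * ?P i (i \<in> S)) * ?P j (j \<in> S)"
      using Pc[OF mem(1)] Pc[OF mem(2)] by (simp add: mat_assoc[where d = d])
    also have "\<dots> = 0\<^sub>m d d" unfolding orth[OF mem(1)] by (rule left_mult_zero_mat[OF Pc[OF mem(2)]])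
    finally show ?thesis by (simp add: 1 ijk)
  next
    case 2
    have "?P j (j \<notin> S) * (?P j (j \<in> S) * ?P i (i \<in> S)) =
        (?P j (j \<notin> S) * ?P j (j \<in> S)) * ?P i (i \<in> S)"
      using Pc[OF mem(1)] Pc[OF mem(2)] by (simp add: mat_assoc[where d = d])
    also have "\<dots> = 0\<^sub>m d d" unfolding orth[OF mem(2)] by (rule left_mult_zero_mat[OF Pc[OF mem(1)]])
    finally show ?thesis by (simp add: 2 ijk PP)
  next
    case 3
    have "k \<notin> S \<longleftrightarrow> (((i \<in> S) \<noteq> (j \<in> S)) \<longleftrightarrow> b l)"
      using odd unfolding odd_card_triple[OF dist sub] by argo
    from spectral_projection_product[OF A[OF mem(1)] A[OF mem(2)] A[OF mem(3)] comm prod this]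
    show ?thesis by (simp add: 3 ijk)
  qed
qed


section \<open>The magic square\<close>

definition mat4 :: "complex list list \<Rightarrow> complex mat" where
  "mat4 xss = mat 4 4 (\<lambda>(i, j). xss ! i ! j)"

text \<open>The Mermin-Peres magic square.  With the Pauli matrices \<open>X\<close>, \<open>Y\<close>, \<open>Z\<close> the nine
  observables are, row by row,
  \<open>X \<otimes> 1\<close>, \<open>1 \<otimes> X\<close>, \<open>X \<otimes> X\<close>; \<open>1 \<otimes> Z\<close>, \<open>Z \<otimes> 1\<close>, \<open>Z \<otimes> Z\<close>;
  \<open>X \<otimes> Z\<close>, \<open>Z \<otimes> X\<close>, \<open>Y \<otimes> Y\<close>.\<close>
definition magic_observable :: "nat \<Rightarrow> complex mat" where
  "magic_observable i = mat4 ([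
     [[0,0,1,0],[0,0,0,1],[1,0,0,0],[0,1,0,0]],
     [[0,1,0,0],[1,0,0,0],[0,0,0,1],[0,0,1,0]],
     [[0,0,0,1],[0,0,1,0],[0,1,0,0],[1,0,0,0]],
     [[1,0,0,0],[0,-1,0,0],[0,0,1,0],[0,0,0,-1]],
     [[1,0,0,0],[0,1,0,0],[0,0,-1,0],[0,0,0,-1]],
     [[1,0,0,0],[0,-1,0,0],[0,0,-1,0],[0,0,0,1]],
     [[0,0,1,0],[0,0,0,-1],[1,0,0,0],[0,-1,0,0]],
     [[0,1,0,0],[1,0,0,0],[0,0,0,-1],[0,0,-1,0]],
     [[0,0,0,-1],[0,0,1,0],[0,1,0,0],[-1,0,0,0]]] ! i)"

text \<open>The three rows of the square and then its three columns.  The observables on a line multiply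
  to the identity, except on line 5, the last column, where they multiply to minus the identity.\<close>
definition magic_line :: "nat \<Rightarrow> nat \<times> nat \<times> nat" where
  "magic_line l = [(0,1,2), (3,4,5), (6,7,8), (0,3,6), (1,4,7), (2,5,8)] ! l"

lemma all_less_4: "(\<forall>i<(4::nat). P i) \<longleftrightarrow> P 0 \<and> P 1 \<and> P 2 \<and> P 3"
  by (auto simp: numeral_eq_Suc less_Suc_eq)

lemma less_9: "(i::nat) < 9 \<longleftrightarrow> i \<in> {0, 1, 2, 3, 4, 5, 6, 7, 8}" by auto

lemma less_6: "(l::nat) < 6 \<longleftrightarrow> l \<in> {0, 1, 2, 3, 4, 5}" by auto

lemma mat4_carrier: "mat4 xss \<in> carrier_mat 4 4"
  by (simp add: mat4_def)

lemma mat4_mult_eq_iff: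
  "mat4 M * mat4 N = mat 4 4 f \<longleftrightarrow>
     (\<forall>i<4. \<forall>j<4. M ! i ! 0 * N ! 0 ! j + M ! i ! 1 * N ! 1 ! j + M ! i ! 2 * N ! 2 ! j + M ! i ! 3 * N ! 3 ! j = f (i, j))"
proof -
  have "(mat4 M * mat4 N) $$ (i, j) =
      M ! i ! 0 * N ! 0 ! j + M ! i ! 1 * N ! 1 ! j + M ! i ! 2 * N ! 2 ! j + M ! i ! 3 * N ! 3 ! j"
    if "i < 4" "j < 4" for i j
    using that by (simp add: mat4_def scalar_prod_def numeral_eq_Suc)
  moreover have "mat4 M * mat4 N \<in> carrier_mat 4 4" by (rule mat_closed) (rule mat4_carrier)+
  ultimately show ?thesis by (auto simp: mat_eq_iff)
qed

lemma one_mat_4: "1\<^sub>m 4 = mat 4 4 (\<lambda>(i, j). if i = j then 1 else 0)"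
  by (simp add: one_mat_def)

lemma smult_mat4: "c \<cdot>\<^sub>m mat4 M = mat 4 4 (\<lambda>(i, j). c * M ! i ! j)"
  by (auto simp: mat4_def)

lemma observable_magic_observable:
  assumes "i < 9"
  shows "observable 4 (magic_observable i)"
proof -
  have "magic_observable i * magic_observable i = 1\<^sub>m 4"
    using assms unfolding less_9 magic_observable_def one_mat_4 mat4_mult_eq_iff all_less_4
    by (elim insertE emptyE) simp_all
  moreover have "\<forall>k<4. \<forall>l<4. magic_observable i $$ (l, k) = cnj (magic_observable i $$ (k, l))"
    using assms unfolding less_9 all_less_4
    by (elim insertE emptyE) (simp_all add: magic_observable_def mat4_def)
  moreover have "magic_observable i \<in> carrier_mat 4 4"
    unfolding magic_observable_def by (rule mat4_carrier)
  ultimately show ?thesis unfolding observable_def by (intro conjI)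
qed

lemma magic_line_product:
  assumes "l < 6" "magic_line l = (i, j, k)"
  shows "magic_observable i * magic_observable j = parity_sign (l = 5) \<cdot>\<^sub>m magic_observable k"
    and "magic_observable j * magic_observable i = parity_sign (l = 5) \<cdot>\<^sub>m magic_observable k"
proof -
  have "\<forall>(i, j, k) \<in> {magic_line l}.
      magic_observable i * magic_observable j = parity_sign (l = 5) \<cdot>\<^sub>m magic_observable k \<and>
      magic_observable j * magic_observable i = parity_sign (l = 5) \<cdot>\<^sub>m magic_observable k"
    using assms(1) unfolding less_6
    by (elim insertE emptyE; simp add: magic_line_def)
      (simp_all add: magic_observable_def smult_mat4 mat4_mult_eq_iff all_less_4)
  then show "magic_observable i * magic_observable j = parity_sign (l = 5) \<cdot>\<^sub>m magic_observable k"
    and "magic_observable j * magic_observable i = parity_sign (l = 5) \<cdot>\<^sub>m magic_observable k"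
    using assms(2) by auto
qed

definition magic_scope :: "nat \<Rightarrow> nat set" where
  "magic_scope l = (case magic_line l of (i, j, k) \<Rightarrow> {i, j, k})"

lemma magic_line_valid:
  assumes "l < 6" "magic_line l = (i, j, k)"
  shows "distinct [i, j, k]" "{i, j, k} \<subseteq> {..<9}"
proof -
  have "\<forall>(i, j, k) \<in> {magic_line l}. distinct [i, j, k] \<and> {i, j, k} \<subseteq> {..<9}"
    using assms(1) unfolding less_6 by (elim insertE emptyE) (simp_all add: magic_line_def)
  then show "distinct [i, j, k]" "{i, j, k} \<subseteq> {..<9}" using assms(2) by auto
qed

interpretation magic: linear_system "{..<9}" "{..<6}" magic_scope
proof
  fix l assume "l \<in> {..<6::nat}"
  moreover obtain i j k where ijk: "magic_line l = (i, j, k)" by (cases "magic_line l")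
  ultimately show "magic_scope l \<subseteq> {..<9}" "3 \<le> card (magic_scope l)"
    using magic_line_valid[of l i j k] by (auto simp: magic_scope_def)
next
  show "{..<9::nat} \<noteq> {}" by (metis lessThan_iff empty_iff zero_less_numeral)
qed auto

text \<open>Each variable lies in one row and one column, so the sum of the row parities equals that of
  the column parities; but the former is even and the latter is odd.\<close>
lemma magic_square_no_solution:
  assumes "\<And>l. l < 6 \<Longrightarrow> odd (card (t \<inter> magic_scope l)) \<longleftrightarrow> l = 5"
  shows False
proof -
  have parity: "(((i \<in> t) \<noteq> (j \<in> t)) \<noteq> (k \<in> t)) \<longleftrightarrow> l = 5" if "l < 6" "magic_line l = (i, j, k)" for l i j k
    using assms[OF that(1)] odd_card_triple[OF magic_line_valid(1)[OF that], of "t \<inter> {i, j, k}"]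
    by (simp add: magic_scope_def that(2))
  show False
    using parity[of 0 0 1 2] parity[of 1 3 4 5] parity[of 2 6 7 8]
      parity[of 3 0 3 6] parity[of 4 1 4 7] parity[of 5 2 5 8]
    by (simp add: magic_line_def) argo
qed

theorem theorem3p13:
  shows "\<exists>(\<Lambda>1 :: (nat, nat) hypergraph) (\<Lambda>2 :: (nat, nat) hypergraph).
    is_hypergraph \<Lambda>1 \<and> full \<Lambda>1 \<and> is_hypergraph \<Lambda>2 \<and> full \<Lambda>2 \<and>
    q_isomorphic \<Lambda>1 \<Lambda>2 \<and> \<not> loc_isomorphic \<Lambda>1 \<Lambda>2"
proof -
  let ?b = "\<lambda>l::nat. l = 5"
  let ?H = "magic.hyp homogeneous" and ?M = "magic.hyp ?b"
  note hyp = magic.is_hypergraph_system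
  obtain \<Lambda>1 :: "(nat, nat) hypergraph" and g1 h1
    where \<Lambda>1: "is_hypergraph \<Lambda>1" "full \<Lambda>1" and iso1: "isomorphism \<Lambda>1 ?H g1 h1"
    using isomorphic_nat_hypergraph[OF hyp magic.full_system] by blast
  obtain \<Lambda>2 :: "(nat, nat) hypergraph" and g2 h2
    where \<Lambda>2: "is_hypergraph \<Lambda>2" "full \<Lambda>2" and iso2: "isomorphism \<Lambda>2 ?M g2 h2"
    using isomorphic_nat_hypergraph[OF hyp magic.full_system] by blast
  have "\<exists>P Q. magic.quantum_solution 4 ?b P Q"
  proof (intro exI, rule magic.quantum_solution_from_observables)
    show "observable 4 (magic_observable i)" if "i \<in> {..<9}" for i
      using observable_magic_observable that by simp
    show "magic_scope l = {i, j, k} \<and> distinct [i, j, k] \<and>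
        magic_observable i * magic_observable j = parity_sign (l = 5) \<cdot>\<^sub>m magic_observable k \<and>
        magic_observable j * magic_observable i = parity_sign (l = 5) \<cdot>\<^sub>m magic_observable k"
      if "l \<in> {..<6}" "magic_line l = (i, j, k)" for l i j k
    proof (intro conjI)
      have l: "l < 6" using that(1) by simp
      show "magic_scope l = {i, j, k}" using that(2) by (simp add: magic_scope_def)
      show "distinct [i, j, k]" by (rule magic_line_valid(1)[OF l that(2)])
      show "magic_observable i * magic_observable j = parity_sign (l = 5) \<cdot>\<^sub>m magic_observable k"
        and "magic_observable j * magic_observable i = parity_sign (l = 5) \<cdot>\<^sub>m magic_observable k"
        by (rule magic_line_product[OF l that(2)])+
    qed
  qed
  then obtain P Q where "magic.quantum_solution 4 ?b P Q" by blast
  from quantum_isomorphism_transfer[OF magic.quantum_solution_imp_quantum_isomorphism[OF this]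
      iso1 iso2 hyp hyp \<Lambda>1(1) \<Lambda>2(1)]
  have "q_isomorphic \<Lambda>1 \<Lambda>2"
    by (rule quantum_isomorphism_imp_q_isomorphic[rotated 3]) (use \<Lambda>1 \<Lambda>2 in auto)
  moreover have "\<not> loc_isomorphic \<Lambda>1 \<Lambda>2"
  proof
    assume "loc_isomorphic \<Lambda>1 \<Lambda>2"
    then obtain g h where "isomorphism \<Lambda>1 \<Lambda>2 g h" by (rule loc_isomorphic_imp_isomorphism)
    from isomorphism_trans[OF isomorphism_trans[OF isomorphism_sym[OF iso1] this] iso2]
    obtain t where "\<And>l. l \<in> {..<6} \<Longrightarrow> odd (card (t \<inter> magic_scope l)) \<longleftrightarrow> l = 5"
      by (rule magic.isomorphism_imp_solution) auto
    then show False by (intro magic_square_no_solution) simp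
  qed
  ultimately show ?thesis using \<Lambda>1 \<Lambda>2 by blast
qed

end
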